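(* Let $n\ge3$ be an integer and let $\alpha\in(0,\tfrac1n)\cup(\tfrac1n,\tfrac1{n-1})$. Let $|\mathcal X|=n$, $p_X=\mathcal U_n$ (uniform on $\mathcal X$) and $p_{Y|X}=\mathcal H_{n,\alpha}$. For $R\in[0,\log n]$, let $p_{T|X}:\mathcal X\to\mathcal T$ be a maximizer of $\mathrm{IB}(R)=\mathrm{IB}(R,\mathcal U_n,\mathcal H_{n,\alpha})$ of minimal cardinality. Then: (a) If $R=0$, then $T$ is a constant representation, that is, $|\mathcal T|=1$. (b) If $R\in(0,R_c)$, then $|\mathcal T|=n+1$ and $T$ is obtained by time sharing a constant representor $t_0\in\mathcal T$ with probability $1-\frac{R}{R_c}$ and a Hamming channel $\mathcal H_{n,\beta_c}$ with probability $\frac{R}{R_c}$, where $\beta_c=h_n^{-1}(\log n-R_c)$. That is, there are an element $t_0\in\mathcal T$ and a bijection $x'\mapsto t_{x'}$ from $\mathcal X$ to $\mathcal T\setminus\{t_0\}$ such that for all $x,x'\in\mathcal X$: $p_{T|X}(t_0|x)=1-\frac R{R_c}$, and $p_{T|X}(t_{x'}|x)=\frac R{R_c}\big(1-(n-1)\beta_c\big)$ if $x'=x$, and $p_{T|X}(t_{x'}|x)=\frac R{R_c}\beta_c$ if $x'\neq x$. (c) If $R\in[R_c,\log n]$, then $|\mathcal T|=n$ and $T$ is obtained by a Hamming channel $\mathcal H_{n,\beta}$ with $\beta=h_n^{-1}(\log n-R)$. That is, there is a bijection $x'\mapsto t_{x'}$ from $\mathcal X$ to $\mathcal T$ such that $p_{T|X}(t_{x'}|x)=1-(n-1)\beta$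 if $x'=x$ and $p_{T|X}(t_{x'}|x)=\beta$ if $x'\ne x$.
   Context: All random variables take values in finite alphabets; $\log$ is to a fixed base greater than $1$; $H$ denotes Shannon entropy and $I$ mutual information; $0\log0=0$. Hamming channel: for $\mathcal X=\mathcal Y$ with $|\mathcal X|=n\ge2$ and $\alpha\in[0,\frac1{n-1}]$, the channel $\mathcal H_{n,\alpha}$ is $p_{Y|X}(y|x)=1-(n-1)\alpha$ if $x=y$, and $p_{Y|X}(y|x)=\alpha$ if $x\ne y$. Information bottleneck function: given $p_X$ and $p_{Y|X}$, for $R\in[0,H(X)]$, $$\mathrm{IB}(R)=\mathrm{IB}(R,p_X,p_{Y|X})=\max_{p_{T|X}:\ Y-X-T,\ I(X;T)\le R} I(Y;T),$$ where the maximum is over all channels $p_{T|X}$ from $\mathcal X$ to an arbitrary finite alphabet $\mathcal T$, and $Y-X-T$ means that $Y,X,T$ form a Markov chain in that order. A maximizer of $\mathrm{IB}(R)$ is a channel $p_{T|X}:\mathcal X\to\mathcal T$ with $I(X;T)\le R$ and $I(Y;T)=\mathrm{IB}(R)$; it is of minimal cardinality if no channel from $\mathcal X$ to an alphabet with fewer than $|\mathcal T|$ elements is a maximizer of $\mathrm{IB}(R)$. The function $h_n:[0,\frac1{n-1}]\to\mathbb R$ is $h_n(q)=-(1-(n-1)q)\log(1-(n-1)q)-(n-1)q\log q$. It is strictly increasing on $[0,\frac1n]$, and $h_n^{-1}:[0,\log n]\to[0,\frac1n]$ denotes the inverse of its restriction to $[0,\frac1n]$. For $R\in[0,\log n]$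 let $$\varphi(R)=\varphi(R,\mathcal H_{n,\alpha})=\max_{p_X:\ \log n-H(X)\le R}\big(\log n-H(Y)\big),$$ where the maximum is over all distributions $p_X$ on the $n$-element alphabet $\mathcal X$ and $Y$ is the output of $\mathcal H_{n,\alpha}$ with input $X\sim p_X$. Let $\widehat\varphi$ denote the upper concave envelope of $\varphi$ on $[0,\log n]$ (the smallest concave function that is $\ge\varphi$). Then $R_c=\min\{R>0 : \varphi(R)=\widehat\varphi(R)\}$; equivalently, $R_c$ is the unique real number in $(0,\log n)$ with $\frac{d\varphi}{dR}(R_c)=\frac{\varphi(R_c)}{R_c}$. *)

theory Defs
  imports "HOL-Probability.Probability"
begin

section \<open>Entropy and mutual information\<close>

text \<open>
  A distribution is a probability mass function, and a channel from \<open>'x\<close> to \<open>'y\<close> is a function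
  \<open>V :: 'x \<Rightarrow> 'y pmf\<close>, where \<open>pmf (V x) y\<close> is the transition probability from \<open>x\<close> to \<open>y\<close>.
  The parameter \<open>b\<close> is the base of the logarithm throughout.
\<close>

definition pmf_entropy :: "real \<Rightarrow> 'x pmf \<Rightarrow> real" where
  "pmf_entropy b p = prob_space.entropy (measure_pmf p) b (count_space UNIV) (\<lambda>x. x)"

definition mutual_info :: "real \<Rightarrow> 'w pmf \<Rightarrow> ('w \<Rightarrow> 'u) \<Rightarrow> ('w \<Rightarrow> 'v) \<Rightarrow> real" where
  "mutual_info b M U V =
     prob_space.mutual_information (measure_pmf M) b (count_space UNIV) (count_space UNIV) U V"

lemma nn_integral_finite_atoms:
  assumes F: "finite F" "\<And>z. z \<in> F \<Longrightarrow> {z} \<in> sets P" and ae: "AE z in P. z \<in> F"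
  shows "(\<integral>\<^sup>+z. g z \<partial>P) = (\<Sum>z\<in>F. g z * emeasure P {z})"
proof -
  have "(\<integral>\<^sup>+z. g z \<partial>P) = (\<integral>\<^sup>+z. (\<Sum>x\<in>F. g x * indicator {x} z) \<partial>P)"
  proof (rule nn_integral_cong_AE, use ae in eventually_elim)
    case (elim z)
    then have "(\<Sum>x\<in>F. g x * indicator {x} z) = (\<Sum>x\<in>F. if x = z then g z else 0)"
      by (intro sum.cong) auto
    with elim F show ?case by simp
  qed
  also have "\<dots> = (\<Sum>x\<in>F. \<integral>\<^sup>+z. g x * indicator {x} z \<partial>P)"
    by (rule nn_integral_sum) (use F in auto)
  also have "\<dots> = (\<Sum>z\<in>F. g z * emeasure P {z})"
    using F by (intro sum.cong) (auto simp: nn_integral_cmult_indicator)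
  finally show ?thesis .
qed

lemma mutual_info_finite:
  fixes U :: "'w \<Rightarrow> 'u" and V :: "'w \<Rightarrow> 'v"
  assumes b: "1 < b" and fin: "finite (set_pmf M)"
  shows "mutual_info b M U V =
    (\<Sum>(u, v)\<in>U ` set_pmf M \<times> V ` set_pmf M.
       pmf (map_pmf (\<lambda>w. (U w, V w)) M) (u, v) *
       log b (pmf (map_pmf (\<lambda>w. (U w, V w)) M) (u, v) / (pmf (map_pmf U M) u * pmf (map_pmf V M) v)))"
proof -
  define pU where "pU = map_pmf U M"
  define pV where "pV = map_pmf V M"
  define pJ where "pJ = map_pmf (\<lambda>w. (U w, V w)) M"
  define F where "F = U ` set_pmf M \<times> V ` set_pmf M"
  define S where "S = (count_space UNIV :: 'u measure)"
  define T where "T = (count_space UNIV :: 'v measure)"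
  define MU where "MU = distr M S U"
  define MV where "MV = distr M T V"
  define P where "P = MU \<Otimes>\<^sub>M MV"
  define Q where "Q = distr M (S \<Otimes>\<^sub>M T) (\<lambda>w. (U w, V w))"
  define f where "f = (\<lambda>z. indicator F z * (pmf pJ z / (pmf pU (fst z) * pmf pV (snd z))) :: real)"
  have finF: "finite F" using fin by (simp add: F_def)
  have sets_ST: "sets P = sets (S \<Otimes>\<^sub>M T)"
    unfolding P_def MU_def MV_def by (intro sets_pair_measure_cong) auto
  have sngST: "{z} \<in> sets (S \<Otimes>\<^sub>M T)" for z
  proof -
    have "{fst z} \<times> {snd z} \<in> sets (S \<Otimes>\<^sub>M T)"
      by (intro pair_measureI) (auto simp: S_def T_def)
    then show ?thesis by simp
  qed
  have FP: "F \<in> sets P"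
    unfolding sets_ST F_def by (intro pair_measureI) (auto simp: S_def T_def)
  interpret MU: prob_space MU unfolding MU_def by (rule measure_pmf.prob_space_distr) (simp add: S_def)
  interpret MV: prob_space MV unfolding MV_def by (rule measure_pmf.prob_space_distr) (simp add: T_def)
  interpret PP: pair_prob_space MU MV ..
  have eMU: "emeasure MU X = emeasure (measure_pmf pU) X" for X
    unfolding MU_def pU_def by (subst emeasure_distr) (auto simp: S_def)
  have eMV: "emeasure MV X = emeasure (measure_pmf pV) X" for X
    unfolding MV_def pV_def by (subst emeasure_distr) (auto simp: T_def)
  have eP: "emeasure P (X \<times> Y) = emeasure (measure_pmf pU) X * emeasure (measure_pmf pV) Y" for X Y
  proof -
    have "X \<in> sets MU" "Y \<in> sets MV" by (auto simp: MU_def MV_def S_def T_def)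
    then show ?thesis unfolding P_def by (simp add: MV.emeasure_pair_measure_Times eMU eMV)
  qed
  have ePs: "emeasure P {z} = ennreal (pmf pU (fst z) * pmf pV (snd z))" for z
  proof -
    have "{z} = {fst z} \<times> {snd z}" by (cases z) auto
    then show ?thesis using eP[of "{fst z}" "{snd z}"]
      by (simp add: emeasure_pmf_single ennreal_mult)
  qed
  have P1: "prob_space P" unfolding P_def by unfold_locales
  have "emeasure P F = 1"
    unfolding F_def eP using emeasure_pmf[of pU] emeasure_pmf[of pV] by (simp add: pU_def pV_def)
  then have aeP: "AE z in P. z \<in> F"
    using prob_space.AE_in_set_eq_1[OF P1 FP] by (simp add: measure_def)
  have eQ: "emeasure Q C = emeasure (measure_pmf pJ) C" if "C \<in> sets P" for C
    using that unfolding Q_def pJ_def sets_ST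
    by (subst emeasure_distr) (auto simp: S_def T_def space_pair_measure)
  have fnn: "0 \<le> f z" for z by (simp add: f_def)
  have setJ: "set_pmf pJ \<subseteq> F" by (auto simp: pJ_def F_def)
  have fm: "f \<in> borel_measurable P"
  proof -
    have "f = (\<lambda>z. \<Sum>x\<in>F. f x * indicator {x} z)"
    proof
      fix z
      have "(\<Sum>x\<in>F. f x * indicator {x} z) = (\<Sum>x\<in>F. if x = z then f z else 0)"
        by (intro sum.cong) auto
      then show "f z = (\<Sum>x\<in>F. f x * indicator {x} z)"
        using finF by (auto simp: f_def)
    qed
    also have "\<dots> \<in> borel_measurable P"
      by (intro borel_measurable_sum borel_measurable_times borel_measurable_const
          borel_measurable_indicator) (simp add: sets_ST sngST)
    finally show ?thesis .
  qed
  have fz: "ennreal (f z) * emeasure P {z} = ennreal (pmf pJ z)" if z: "z \<in> F" for z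
  proof -
    have "0 < pmf pU (fst z)" "0 < pmf pV (snd z)"
      using z by (auto simp: F_def pU_def pV_def pmf_positive_iff)
    then show ?thesis
      using z by (simp add: ePs f_def ennreal_mult[symmetric])
  qed
  have Qd: "Q = density P (\<lambda>z. ennreal (f z))"
  proof (rule measure_eqI)
    show "sets Q = sets (density P (\<lambda>z. ennreal (f z)))"
      by (simp add: sets_ST Q_def)
  next
    fix C assume "C \<in> sets Q"
    then have C: "C \<in> sets P" by (simp add: sets_ST Q_def)
    have "emeasure (density P (\<lambda>z. ennreal (f z))) C = (\<integral>\<^sup>+z. ennreal (f z) * indicator C z \<partial>P)"
      using fm C by (subst emeasure_density) auto
    also have "\<dots> = (\<Sum>z\<in>F. ennreal (f z) * indicator C z * emeasure P {z})"
      by (rule nn_integral_finite_atoms[OF finF _ aeP]) (simp add: sets_ST sngST)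
    also have "\<dots> = (\<Sum>z\<in>F. ennreal (pmf pJ z) * indicator C z)"
      by (intro sum.cong refl) (metis fz mult.assoc mult.commute)
    also have "\<dots> = (\<Sum>z\<in>F \<inter> C. ennreal (pmf pJ z))"
      using finF by (simp add: sum.inter_restrict indicator_def if_distrib cong: if_cong)
    also have "\<dots> = emeasure (measure_pmf pJ) (F \<inter> C)"
      using finF by (simp add: emeasure_measure_pmf_finite)
    also have "\<dots> = emeasure (measure_pmf pJ) C"
      by (rule emeasure_eq_AE) (use setJ in \<open>auto simp: AE_measure_pmf_iff\<close>)
    finally show "emeasure Q C = emeasure (density P (\<lambda>z. ennreal (f z))) C"
      using eQ[OF C] by simp
  qed
  have "mutual_info b M U V = KL_divergence b P Q"
    unfolding mutual_info_def P_def Q_def MU_def MV_def S_def T_def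
    by (rule prob_space.mutual_information_def) (rule measure_pmf.prob_space_axioms)
  also have "\<dots> = (\<integral>z. f z * log b (f z) \<partial>P)"
  proof -
    interpret P: prob_space P by (rule P1)
    show ?thesis unfolding Qd using fm fnn b by (intro P.KL_density) auto
  qed
  also have "\<dots> = (\<integral>z. (\<Sum>x\<in>F. (f x * log b (f x)) * indicator {x} z) \<partial>P)"
  proof (rule integral_cong_AE)
    show "AE z in P. f z * log b (f z) = (\<Sum>x\<in>F. f x * log b (f x) * indicator {x} z)"
      using aeP
    proof eventually_elim
      case (elim z)
      then have "(\<Sum>x\<in>F. f x * log b (f x) * indicator {x} z) = (\<Sum>x\<in>F. if x = z then f z * log b (f z) else 0)"
        by (intro sum.cong) auto
      with elim finF show ?case by simp
    qed
    show "(\<lambda>z. f z * log b (f z)) \<in> borel_measurable P"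
      using fm by simp
    show "(\<lambda>z. \<Sum>x\<in>F. f x * log b (f x) * indicator {x} z) \<in> borel_measurable P"
      by (intro borel_measurable_sum borel_measurable_times borel_measurable_const
          borel_measurable_indicator) (simp add: sets_ST sngST)
  qed
  also have "\<dots> = (\<Sum>x\<in>F. f x * log b (f x) * measure P {x})"
  proof -
    interpret P: prob_space P by (rule P1)
    have "{x} \<in> sets P" for x by (simp add: sets_ST sngST)
    then show ?thesis
      by (subst Bochner_Integration.integral_sum)
        (auto intro!: integrable_mult_right simp: P.emeasure_eq_measure)
  qed
  also have "\<dots> = (\<Sum>z\<in>F. pmf pJ z * log b (pmf pJ z / (pmf pU (fst z) * pmf pV (snd z))))"
  proof (rule sum.cong[OF refl])
    fix z assume z: "z \<in> F"
    have "0 < pmf pU (fst z)" "0 < pmf pV (snd z)"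
      using z by (auto simp: F_def pU_def pV_def pmf_positive_iff)
    moreover have "measure P {z} = pmf pU (fst z) * pmf pV (snd z)"
      by (simp add: measure_def ePs)
    ultimately show "f z * log b (f z) * measure P {z}
        = pmf pJ z * log b (pmf pJ z / (pmf pU (fst z) * pmf pV (snd z)))"
      using z by (simp add: f_def)
  qed
  finally show ?thesis
    unfolding F_def pU_def pV_def pJ_def by (simp add: case_prod_beta)
qed

lemma pmf_entropy_finite:
  fixes p :: "'x::finite pmf"
  assumes "1 < b"
  shows "pmf_entropy b p = - (\<Sum>x\<in>UNIV. pmf p x * log b (pmf p x))"
proof -
  interpret information_space "measure_pmf p" b by unfold_locales (rule assms)
  have "simple_distributed (measure_pmf p) (\<lambda>x. x) (pmf p)"
    by (auto simp: simple_distributed_def simple_function_def measure_pmf_single distributed_def measure_pmf_eq_density[symmetric]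
        distr_id2)
  from entropy_simple_distributed[OF this] show ?thesis
    by (simp add: pmf_entropy_def)
qed

section \<open>The information bottleneck function\<close>

text \<open>
  The joint distribution of \<open>(Y, X, T)\<close> with \<open>X \<sim> p\<close>, where \<open>Y\<close> and \<open>T\<close> are the outputs of the
  channels \<open>V\<close> and \<open>W\<close>, conditionally independent given \<open>X\<close>. It is the only joint distribution with
  these marginal channels such that \<open>Y - X - T\<close> is a Markov chain.
\<close>

definition markov_joint ::
    "'x pmf \<Rightarrow> ('x \<Rightarrow> 'y pmf) \<Rightarrow> ('x \<Rightarrow> 't pmf) \<Rightarrow> ('y \<times> 'x \<times> 't) pmf" where
  "markov_joint p V W =
     bind_pmf p (\<lambda>x. bind_pmf (V x) (\<lambda>y. bind_pmf (W x) (\<lambda>t. return_pmf (y, x, t))))"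

lemma pmf_markov_joint:
  "pmf (markov_joint p V W) (y, x, t) = pmf p x * pmf (V x) y * pmf (W x) t"
proof -
  have "markov_joint p V W =
     bind_pmf p (\<lambda>x. map_pmf (\<lambda>(y, t). (y, x, t)) (pair_pmf (V x) (W x)))"
    by (simp add: markov_joint_def pair_pmf_def map_bind_pmf)
  then have "pmf (markov_joint p V W) (y, x, t) =
     measure_pmf.expectation p (\<lambda>x'. pmf (map_pmf (\<lambda>(y, t). (y, x', t)) (pair_pmf (V x') (W x'))) (y, x, t))"
    by (simp add: pmf_bind)
  also have "\<dots> = measure_pmf.expectation p (\<lambda>x'. indicator {x} x' * (pmf (V x) y * pmf (W x) t))"
  proof (rule Bochner_Integration.integral_cong[OF refl])
    fix x'
    have "pmf (map_pmf (\<lambda>(y, t). (y, x', t)) (pair_pmf (V x') (W x'))) (y, x, t) =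
       measure (pair_pmf (V x') (W x')) {z. (\<lambda>(y, t). (y, x', t)) z = (y, x, t)}"
      by (simp add: pmf_map vimage_def)
    also have "{z. (\<lambda>(y, t). (y, x', t)) z = (y, x, t)} = (if x' = x then {(y, t)} else {})"
      by auto
    finally show "pmf (map_pmf (\<lambda>(y, t). (y, x', t)) (pair_pmf (V x') (W x'))) (y, x, t) =
        indicator {x} x' * (pmf (V x) y * pmf (W x) t)"
      by (simp add: measure_pmf_single pmf_pair)
  qed
  also have "\<dots> = pmf p x * pmf (V x) y * pmf (W x) t"
    by (simp add: measure_pmf_single)
  finally show ?thesis .
qed

definition info_XT :: "real \<Rightarrow> 'x pmf \<Rightarrow> ('x \<Rightarrow> 'y pmf) \<Rightarrow> ('x \<Rightarrow> 't pmf) \<Rightarrow> real" where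
  "info_XT b p V W = mutual_info b (markov_joint p V W) (\<lambda>(y, x, t). x) (\<lambda>(y, x, t). t)"

definition info_YT :: "real \<Rightarrow> 'x pmf \<Rightarrow> ('x \<Rightarrow> 'y pmf) \<Rightarrow> ('x \<Rightarrow> 't pmf) \<Rightarrow> real" where
  "info_YT b p V W = mutual_info b (markov_joint p V W) (\<lambda>(y, x, t). y) (\<lambda>(y, x, t). t)"

definition channel_into :: "'t set \<Rightarrow> ('x \<Rightarrow> 't pmf) \<Rightarrow> bool" where
  "channel_into A W \<longleftrightarrow> finite A \<and> (\<forall>x. set_pmf (W x) \<subseteq> A)"

text \<open>
  Up to renaming of letters every finite alphabet is a finite set of natural numbers, so letting the
  alphabet range over finite sets of natural numbers covers all finite alphabets. The supremum is a
  maximum.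
\<close>

definition IB :: "real \<Rightarrow> real \<Rightarrow> 'x pmf \<Rightarrow> ('x \<Rightarrow> 'y pmf) \<Rightarrow> real" where
  "IB b R p V =
     Sup {info_YT b p V W | (A :: nat set) W. channel_into A W \<and> info_XT b p V W \<le> R}"

definition IB_maximizer ::
    "real \<Rightarrow> real \<Rightarrow> 'x pmf \<Rightarrow> ('x \<Rightarrow> 'y pmf) \<Rightarrow> 't set \<Rightarrow> ('x \<Rightarrow> 't pmf) \<Rightarrow> bool" where
  "IB_maximizer b R p V A W \<longleftrightarrow>
     channel_into A W \<and> info_XT b p V W \<le> R \<and> info_YT b p V W = IB b R p V"

definition minimal_IB_maximizer ::
    "real \<Rightarrow> real \<Rightarrow> 'x pmf \<Rightarrow> ('x \<Rightarrow> 'y pmf) \<Rightarrow> 't set \<Rightarrow> ('x \<Rightarrow> 't pmf) \<Rightarrow> bool" where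
  "minimal_IB_maximizer b R p V A W \<longleftrightarrow>
     IB_maximizer b R p V A W \<and>
     \<not> (\<exists>(A' :: nat set) W'. card A' < card A \<and> IB_maximizer b R p V A' W')"

section \<open>Hamming channels\<close>

text \<open>The alphabet is the whole type; for \<open>a\<close> outside \<open>[0, 1/(n-1)]\<close> the value is unspecified.\<close>

definition hamming_channel :: "real \<Rightarrow> 'x::finite \<Rightarrow> 'x pmf" where
  "hamming_channel a x =
     embed_pmf (\<lambda>y. if x = y then 1 - (real CARD('x) - 1) * a else a)"

lemma pmf_hamming_channel:
  fixes x y :: "'x::finite"
  assumes "0 \<le> a" "(real CARD('x) - 1) * a \<le> 1"
  shows "pmf (hamming_channel a x) y = (if x = y then 1 - (real CARD('x) - 1) * a else a)"
proof -
  let ?f = "\<lambda>y. if x = y then 1 - (real CARD('x) - 1) * a else a"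
  have nn: "0 \<le> ?f y" for y
    using assms by auto
  have "(\<Sum>y\<in>UNIV. ?f y) = ?f x + (\<Sum>y\<in>UNIV - {x}. ?f y)"
    by (rule sum.remove) auto
  also have "(\<Sum>y\<in>UNIV - {x}. ?f y) = (\<Sum>y\<in>UNIV - {x}. a)"
    by (rule sum.cong) auto
  also have "\<dots> = (real CARD('x) - 1) * a"
    by (simp add: card_Diff_singleton of_nat_diff Suc_leI)
  finally have s: "(\<Sum>y\<in>UNIV. ?f y) = 1"
    by simp
  have "(\<integral>\<^sup>+y. ennreal (?f y) \<partial>count_space UNIV) = ennreal (\<Sum>y\<in>UNIV. ?f y)"
    using nn by (simp only: nn_integral_count_space_finite[OF finite] sum_ennreal)
  then show ?thesis
    unfolding hamming_channel_def using nn s by (subst pmf_embed_pmf) auto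
qed

definition h_fun :: "real \<Rightarrow> nat \<Rightarrow> real \<Rightarrow> real" where
  "h_fun b n q =
     - (1 - (real n - 1) * q) * log b (1 - (real n - 1) * q) - (real n - 1) * q * log b q"

definition h_inv :: "real \<Rightarrow> nat \<Rightarrow> real \<Rightarrow> real" where
  "h_inv b n = the_inv_into {0..1 / real n} (h_fun b n)"

section \<open>The critical rate\<close>

text \<open>The supremum is a maximum over a compact set of distributions.\<close>

definition phi :: "real \<Rightarrow> ('x::finite \<Rightarrow> 'x pmf) \<Rightarrow> real \<Rightarrow> real" where
  "phi b V R =
     Sup {log b (real CARD('x)) - pmf_entropy b (bind_pmf p V) | p.
            log b (real CARD('x)) - pmf_entropy b p \<le> R}"

definition concave_envelope :: "real set \<Rightarrow> (real \<Rightarrow> real) \<Rightarrow> real \<Rightarrow> real" where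
  "concave_envelope S f x = Inf {g x | g. concave_on S g \<and> (\<forall>y\<in>S. f y \<le> g y)}"

definition critical_rate :: "real \<Rightarrow> ('x::finite \<Rightarrow> 'x pmf) \<Rightarrow> real" where
  "critical_rate b V =
     (LEAST R. 0 < R \<and> R \<le> log b (real CARD('x)) \<and>
        phi b V R = concave_envelope {0..log b (real CARD('x))} (phi b V) R)"

end

theory Submission
  imports Defs "HOL-Real_Asymp.Real_Asymp"
begin

text \<open>
  With \<open>X\<close> uniform, both informations are averages over \<open>t\<close> of divergences from the uniform
  distribution: \<open>I(X;T)\<close> averages \<open>D \<mu>\<^sub>t\<close> and \<open>I(Y;T)\<close> averages \<open>E \<mu>\<^sub>t\<close>, where \<open>\<mu>\<^sub>t\<close> is the posterior of
  \<open>X\<close> given \<open>t\<close>, \<open>D\<close> its divergence and \<open>E\<close> that of the channel output. Hence a multiplier \<open>l \<ge> 0\<close> with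
  \<open>E \<mu> - l D \<mu> \<le> M\<close> for all \<open>\<mu>\<close> gives \<open>I(Y;T) \<le> l R + M\<close>, and in a maximizer every posterior attains
  the bound. The Lagrangian is a sum over the letters of a function that is concave and then convex,
  so its maximizers have at most one exceptional, larger entry: they are rows of Hamming channels.
  Along this one-parameter family the second derivative of the Lagrangian has the sign of a
  quadratic polynomial, which shows that the curve \<open>(D, E)\<close> has a single tangent through the origin,
  touching it at \<open>R\<^sub>c\<close>, and lies strictly below each of its tangents beyond that point. Finally, the
  posteriors average to the uniform distribution, so each input letter is the peak of at least one
  of them, and minimal cardinality leaves exactly one.
\<close>

section \<open>The function z ln z on the half-line\<close>

definition xlnx :: "real \<Rightarrow> real" where
  "xlnx z = z * ln z"

lemma xlnx_0 [simp]: "xlnx 0 = 0" and xlnx_1 [simp]: "xlnx 1 = 0"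
  by (simp_all add: xlnx_def)

text \<open>Only the point 0 needs an argument: the product is 0 there, which is also the limit of z
  ln z from the right.\<close>

lemma continuous_on_xlnx: "continuous_on {0..} xlnx"
  unfolding continuous_on_def
proof
  fix x :: real
  assume x: "x \<in> {0..}"
  show "(xlnx \<longlongrightarrow> xlnx x) (at x within {0..})"
  proof (cases "x = 0")
    case True
    have "at x within {0..} = at_right x"
      using True at_within_Ici_at_right by blast
    moreover have "((\<lambda>z::real. z * ln z) \<longlongrightarrow> 0) (at_right 0)"
      by real_asymp
    ultimately show ?thesis
      using True by (simp add: xlnx_def[abs_def])
  next
    case False
    with x have "isCont xlnx x"
      unfolding xlnx_def by (intro continuous_intros) auto
    then show ?thesis
      by (meson isContD tendsto_within_subset subset_UNIV)
  qed
qed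

lemma continuous_on_xlnx_compose:
  assumes "continuous_on S f" "\<And>x. x \<in> S \<Longrightarrow> 0 \<le> f x"
  shows "continuous_on S (\<lambda>x. xlnx (f x))"
  using continuous_on_compose2[OF continuous_on_xlnx assms(1)] assms(2) by auto

lemma DERIV_xlnx:
  assumes "(f has_real_derivative f') (at x within S)" "0 < f x"
  shows "((\<lambda>x. xlnx (f x)) has_real_derivative f' * (ln (f x) + 1)) (at x within S)"
  unfolding xlnx_def
  by (rule derivative_eq_intros assms refl)+ (use assms(2) in \<open>simp add: field_simps\<close>)

lemma DERIV_ln_compose:
  assumes "(f has_real_derivative f') (at x within S)" "0 < f x"
  shows "((\<lambda>x. ln (f x)) has_real_derivative f' / f x) (at x within S)"
  using DERIV_chain2[where f = ln and g = f, OF DERIV_ln_divide[OF assms(2)] assms(1)] by simp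

text \<open>Interpolation identity: up to the factor \<open>z - x\<close>, the excess of a quadratic
  over its chord is \<open>C\<close> times a product that is positive for \<open>x < y < z\<close>.
  The sign of \<open>C\<close> tells on which side of the chord the value lies.\<close>

lemma quadratic_chord:
  fixes A B C :: real
  assumes q: "\<And>x. q x = A + B * x - C * x\<^sup>2"
  shows "(z - x) * q y = (z - y) * q x + (y - x) * q z + C * ((y - x) * (z - y) * (z - x))"
  unfolding q by algebra

section \<open>The Lagrangian along the one-parameter family of peaked distributions\<close>

locale hamming_gain =
  fixes n :: nat and s :: real
  assumes n3: "3 \<le> n" and s0: "s \<noteq> 0" and s1: "s < 1" and s2: "- 1 < (real n - 1) * s"
begin

text \<open>\<open>X e\<close> and \<open>X (s * e)\<close> are the divergences from the uniform distribution (in nats) of the input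
  distribution \<open>((1 + k e) / n, (1 - e) / n, \<dots>, (1 - e) / n)\<close> and of the corresponding output of the
  Hamming channel with \<open>s = 1 - n \<alpha>\<close>. Up to positive factors \<open>m\<close> is the derivative of \<open>X\<close>, \<open>g l\<close> that of
  the Lagrangian \<open>G l\<close>, and the quadratic \<open>Q l\<close> that of \<open>g l\<close>.\<close>

definition k :: real where "k = real n - 1"

definition m :: "real \<Rightarrow> real" where "m e = ln (1 + k * e) - ln (1 - e)"

definition X :: "real \<Rightarrow> real" where "X e = (xlnx (1 + k * e) + k * xlnx (1 - e)) / real n"

definition g :: "real \<Rightarrow> real \<Rightarrow> real" where "g l e = s * m (s * e) - l * m e"

definition G :: "real \<Rightarrow> real \<Rightarrow> real" where "G l e = X (s * e) - l * X e"

definition Q :: "real \<Rightarrow> real \<Rightarrow> real" where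
  "Q l e = s\<^sup>2 * ((1 + k * e) * (1 - e)) - l * ((1 + k * (s * e)) * (1 - s * e))"

lemma k2: "2 \<le> k" and n_eq: "real n = k + 1" and ks: "- 1 < k * s"
  using n3 s2 by (simp_all add: k_def)

text \<open>The bounds on \<open>s\<close> say that all transition probabilities of the channel are
  positive. Hence the output stays inside the simplex even at \<open>e = 1\<close>, and only the
  input divergence becomes singular there.\<close>

lemma scaled_dom:
  assumes "0 \<le> e" "e \<le> 1"
  shows "0 < 1 + k * (s * e)" "0 < 1 - s * e"
proof -
  have "- 1 < (k * s) * e"
  proof (cases "k * s \<ge> 0")
    case True
    then have "0 \<le> (k * s) * e" using assms by (rule_tac mult_nonneg_nonneg)
    then show ?thesis by linarith
  next
    case False
    then have "k * s * 1 \<le> k * s * e" using assms by (intro mult_left_mono_neg) auto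
    then show ?thesis using ks by linarith
  qed
  then show "0 < 1 + k * (s * e)" by (simp only: mult.assoc)
  have "s * e < 1"
  proof (cases "s \<ge> 0")
    case True
    then have "s * e \<le> s * 1" using assms by (intro mult_left_mono) auto
    then show ?thesis using s1 by linarith
  next
    case False
    then have "s * e \<le> 0" using assms by (intro mult_nonpos_nonneg) auto
    then show ?thesis by linarith
  qed
  then show "0 < 1 - s * e" by linarith
qed

lemma plain_dom: "0 \<le> e \<Longrightarrow> 0 < 1 + k * e"
  using k2 by (intro add_pos_nonneg mult_nonneg_nonneg) auto

lemma X_DERIV:
  assumes "0 < 1 + k * e" "e < 1"
  shows "(X has_real_derivative k / real n * m e) (at e)"
proof -
  have "((\<lambda>e. 1 + k * e) has_real_derivative k) (at e)"
    and "((\<lambda>e. 1 - e) has_real_derivative - 1) (at e)"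
    by (auto intro!: derivative_eq_intros)
  from DERIV_xlnx[OF this(1)] DERIV_xlnx[OF this(2)] assms
  have "((\<lambda>e. xlnx (1 + k * e)) has_real_derivative k * (ln (1 + k * e) + 1)) (at e)"
    and "((\<lambda>e. xlnx (1 - e)) has_real_derivative - 1 * (ln (1 - e) + 1)) (at e)"
    by simp_all
  then have "((\<lambda>e. (xlnx (1 + k * e) + k * xlnx (1 - e)) / real n) has_real_derivative
     (k * (ln (1 + k * e) + 1) + k * (- 1 * (ln (1 - e) + 1))) / real n) (at e)"
    by (intro DERIV_cdivide DERIV_add DERIV_cmult)
  then show ?thesis by (simp add: X_def[abs_def] m_def right_diff_distrib distrib_left diff_divide_distrib)
qed

lemma m_DERIV:
  assumes "0 < 1 + k * e" "e < 1"
  shows "(m has_real_derivative real n / ((1 + k * e) * (1 - e))) (at e)"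
proof -
  have "((\<lambda>e. 1 + k * e) has_real_derivative k) (at e)"
    and "((\<lambda>e. 1 - e) has_real_derivative - 1) (at e)"
    by (auto intro!: derivative_eq_intros)
  then have "(m has_real_derivative k / (1 + k * e) - - 1 / (1 - e)) (at e)"
    unfolding m_def[abs_def] using assms by (intro DERIV_diff DERIV_ln_compose) auto
  moreover have "k / a - - 1 / c = (k * c + a) / (a * c)" if "0 < a" "0 < c" for a c :: real
    using that by (simp add: field_simps)
  ultimately show ?thesis
    using assms by (simp add: n_eq algebra_simps)
qed

lemma G_DERIV:
  assumes "0 \<le> e" "e < 1"
  shows "(G l has_real_derivative k / real n * g l e) (at e)"
proof -
  have d1: "(X has_real_derivative k / real n * m e) (at e)"
    using assms plain_dom by (intro X_DERIV) auto
  have d2: "(X has_real_derivative k / real n * m (s * e)) (at (s * e))"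
    using assms scaled_dom[of e] by (intro X_DERIV) auto
  have "((\<lambda>e. X (s * e)) has_real_derivative k / real n * m (s * e) * s) (at e)"
    by (rule DERIV_chain2[where f = X and g = "\<lambda>e. s * e", OF d2]) (auto intro!: derivative_eq_intros)
  then have "((\<lambda>e. X (s * e) - l * X e) has_real_derivative
     k / real n * m (s * e) * s - l * (k / real n * m e)) (at e)"
    by (intro DERIV_diff DERIV_cmult d1)
  then show ?thesis by (simp add: G_def[abs_def] g_def algebra_simps)
qed

lemma g_DERIV:
  assumes "0 \<le> e" "e < 1"
  shows "(g l has_real_derivative
    real n * Q l e / (((1 + k * e) * (1 - e)) * ((1 + k * (s * e)) * (1 - s * e)))) (at e)"
proof -
  note dom = scaled_dom[of e] plain_dom[of e]
  have d1: "(m has_real_derivative real n / ((1 + k * e) * (1 - e))) (at e)"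
    using assms dom by (intro m_DERIV) auto
  have d2: "(m has_real_derivative real n / ((1 + k * (s * e)) * (1 - s * e))) (at (s * e))"
    using assms dom by (intro m_DERIV) auto
  have "((\<lambda>e. m (s * e)) has_real_derivative
      real n / ((1 + k * (s * e)) * (1 - s * e)) * s) (at e)"
    by (rule DERIV_chain2[where f = m and g = "\<lambda>e. s * e", OF d2]) (auto intro!: derivative_eq_intros)
  then have *: "((\<lambda>e. s * m (s * e) - l * m e) has_real_derivative
      s * (real n / ((1 + k * (s * e)) * (1 - s * e)) * s)
      - l * (real n / ((1 + k * e) * (1 - e)))) (at e)"
    by (intro DERIV_diff DERIV_cmult d1)
  have alg: "s * (N / b * s) - l * (N / a) = N * (s\<^sup>2 * a - l * b) / (a * b)"
    if "0 < a" "0 < b" for a b N :: real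
    using that by (simp add: field_simps power2_eq_square)
  have "0 < (1 + k * e) * (1 - e)" "0 < (1 + k * (s * e)) * (1 - s * e)"
    using dom assms by simp_all
  from alg[OF this, of "real n"] show ?thesis
    using * by (simp only: Q_def g_def[abs_def])
qed

lemma continuous_on_X_compose:
  assumes f: "continuous_on S f" and dom: "\<And>e. e \<in> S \<Longrightarrow> 0 \<le> 1 + k * f e" "\<And>e. e \<in> S \<Longrightarrow> f e \<le> 1"
  shows "continuous_on S (\<lambda>e. X (f e))"
proof -
  have "continuous_on S (\<lambda>e. 1 + k * f e)" "continuous_on S (\<lambda>e. 1 - f e)"
    by (intro continuous_intros f)+
  from this[THEN continuous_on_xlnx_compose] dom
  have "continuous_on S (\<lambda>e. xlnx (1 + k * f e))" "continuous_on S (\<lambda>e. xlnx (1 - f e))"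
    by simp_all
  then show ?thesis
    unfolding X_def by (intro continuous_on_divide continuous_on_add continuous_on_mult_left
        continuous_on_const) (use n3 in auto)
qed

lemma X_continuous: "continuous_on {0..1} X"
  by (rule continuous_on_X_compose[OF continuous_on_id]) (use plain_dom in \<open>auto intro: less_imp_le\<close>)

lemma G_continuous: "continuous_on {0..1} (G l)"
proof -
  have "continuous_on {0..1} (\<lambda>e. X (s * e))"
    by (rule continuous_on_X_compose[OF continuous_on_mult_left[OF continuous_on_id]])
      (use scaled_dom in \<open>auto intro: less_imp_le\<close>)
  then show ?thesis
    unfolding G_def[abs_def] by (intro continuous_on_diff continuous_on_mult_left X_continuous)
qed

lemma m_0 [simp]: "m 0 = 0" and X_0 [simp]: "X 0 = 0" and g_0 [simp]: "g l 0 = 0"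
  and G_0 [simp]: "G l 0 = 0"
  by (simp_all add: m_def X_def g_def G_def)

lemma X_1: "X 1 = ln (real n)"
  using k2 by (simp add: X_def n_eq xlnx_def add.commute)

text \<open>\<open>m z\<close> compares \<open>1 + k * z\<close> with \<open>1 - z\<close>, so it
  has the sign of \<open>z\<close>. Negative arguments are covered because \<open>s\<close> may be
  negative.\<close>

lemma m_sign:
  assumes "0 < 1 + k * z" "z < 1" "z \<noteq> 0"
  shows "0 < z * m z"
proof (cases "0 < z")
  case True
  then have "0 < k * z" using k2 by simp
  then have "1 - z < 1 + k * z" using True by linarith
  then have "ln (1 - z) < ln (1 + k * z)" using assms by (subst ln_less_cancel_iff) auto
  then show ?thesis using True by (simp add: m_def)
next
  case False
  then have z: "z < 0" using assms by simp
  then have "k * z < 0" using k2 by (simp add: mult_pos_neg)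
  then have "1 + k * z < 1 - z" using z by linarith
  then have "ln (1 + k * z) < ln (1 - z)" using assms by (subst ln_less_cancel_iff) auto
  then show ?thesis using z by (simp add: m_def mult_neg_neg)
qed

lemma m_pos: "0 < e \<Longrightarrow> e < 1 \<Longrightarrow> 0 < m e"
  using m_sign[of e] plain_dom[of e] by (simp add: zero_less_mult_iff)

text \<open>The factor \<open>s\<close> occurs outside and inside, so its sign cancels: the output
  divergence grows with \<open>e\<close> for either sign of \<open>s\<close>.\<close>

lemma scaled_m_pos:
  assumes "0 < e" "e \<le> 1"
  shows "0 < s * m (s * e)"
proof -
  have "0 < (s * e) * m (s * e)"
    by (rule m_sign) (use scaled_dom[of e] s0 assms in auto)
  then have "0 < e * (s * m (s * e))" by (simp add: mult_ac)
  then show ?thesis using assms(1) by (rule zero_less_mult_pos)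
qed

lemma G_less:
  assumes "0 \<le> u" "u < v" "v \<le> 1" and "\<And>e. u < e \<Longrightarrow> e < v \<Longrightarrow> 0 < g l e"
  shows "G l u < G l v"
proof (rule DERIV_pos_imp_increasing_open[OF assms(2)])
  fix e assume e: "u < e" "e < v"
  have "(G l has_real_derivative k / real n * g l e) (at e)" using e assms by (intro G_DERIV) auto
  moreover have "0 < k / real n * g l e" using assms(4)[OF e] k2 n3 by simp
  ultimately show "\<exists>y. (G l has_real_derivative y) (at e) \<and> 0 < y" by blast
next
  show "continuous_on {u..v} (G l)"
    by (rule continuous_on_subset[OF G_continuous]) (use assms in auto)
qed

lemma G_greater:
  assumes "0 \<le> u" "u < v" "v \<le> 1" and "\<And>e. u < e \<Longrightarrow> e < v \<Longrightarrow> g l e < 0"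
  shows "G l v < G l u"
proof (rule DERIV_neg_imp_decreasing_open[OF assms(2)])
  fix e assume e: "u < e" "e < v"
  have "(G l has_real_derivative k / real n * g l e) (at e)" using e assms by (intro G_DERIV) auto
  moreover have "k / real n * g l e < 0" using assms(4)[OF e] k2 n3 by (intro mult_pos_neg) auto
  ultimately show "\<exists>y. (G l has_real_derivative y) (at e) \<and> y < 0" by blast
next
  show "continuous_on {u..v} (G l)"
    by (rule continuous_on_subset[OF G_continuous]) (use assms in auto)
qed

lemma X_strict_mono:
  assumes "0 \<le> u" "u < v" "v \<le> 1"
  shows "X u < X v"
proof (rule DERIV_pos_imp_increasing_open[OF assms(2)])
  fix e assume e: "u < e" "e < v"
  then have e01: "0 < e" "e < 1" using assms by linarith+
  have "(X has_real_derivative k / real n * m e) (at e)"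
    by (rule X_DERIV[OF plain_dom e01(2)]) (use e01 in simp)
  moreover have "0 < k / real n * m e"
    by (rule mult_pos_pos[OF _ m_pos[OF e01]]) (use k2 n3 in simp)
  ultimately show "\<exists>y. (X has_real_derivative y) (at e) \<and> 0 < y" by blast
next
  show "continuous_on {u..v} X"
    by (rule continuous_on_subset[OF X_continuous]) (use assms in auto)
qed

lemma X_pos: "0 < e \<Longrightarrow> e \<le> 1 \<Longrightarrow> 0 < X e"
  using X_strict_mono[of 0 e] by simp

text \<open>With multiplier 0 the Lagrangian is the output divergence alone, which increases. This
  serves the largest rate, log n, where the posteriors are point masses.\<close>

lemma G_zero_slope_less:
  assumes "0 \<le> e" "e < 1"
  shows "G 0 e < G 0 1"
proof (rule G_less)
  show "0 < g 0 e'" if "e < e'" "e' < 1" for e'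
    using scaled_m_pos[of e'] that assms by (simp add: g_def)
qed (use assms in auto)

lemma Q_quadratic:
  "Q l e = (s\<^sup>2 - l) + (k - 1) * s * (s - l) * e - k * s\<^sup>2 * (1 - l) * e\<^sup>2"
  unfolding Q_def by algebra

lemma Q_1: "0 < l \<Longrightarrow> Q l 1 < 0"
  using scaled_dom[of 1] by (simp add: Q_def)

text \<open>Mean value theorem with all positive factors collected in \<open>d\<close>, so that
  increments of \<open>g l\<close> take the sign of the quadratic \<open>Q l\<close> at an
  intermediate point.\<close>

lemma g_mvt:
  assumes "0 \<le> u" "u < v" "v < 1"
  obtains z d where "u < z" "z < v" "0 < d" "g l v - g l u = d * Q l z"
proof -
  have "\<exists>z>u. z < v \<and> g l v - g l u = (v - u) *
     (real n * Q l z / (((1 + k * z) * (1 - z)) * ((1 + k * (s * z)) * (1 - s * z))))"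
    by (rule MVT2) (use assms g_DERIV in auto)
  then obtain z where z: "u < z" "z < v" and
    eq: "g l v - g l u = (v - u) *
     (real n * Q l z / (((1 + k * z) * (1 - z)) * ((1 + k * (s * z)) * (1 - s * z))))" by blast
  let ?d = "(v - u) * (real n / (((1 + k * z) * (1 - z)) * ((1 + k * (s * z)) * (1 - s * z))))"
  have "0 < ?d" using assms z scaled_dom[of z] plain_dom[of z] n3 by simp
  then show ?thesis using that[OF z] eq by simp
qed

text \<open>If \<open>Q l\<close> is strictly concave, it cannot be nonpositive at \<open>y\<close>
  between two points where it is nonnegative. Otherwise it lies on or below its chord from
  \<open>y\<close> to 1, which is negative at \<open>z\<close> because
  \<open>Q l 1 < 0\<close>.\<close>

lemma Q_stays_negative:
  assumes l: "0 < l" and "x < y" "y < z" "z < 1" "0 \<le> Q l x" "Q l y \<le> 0"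
  shows "Q l z < 0"
proof (rule ccontr)
  assume "\<not> Q l z < 0"
  then have z0: "0 \<le> Q l z" by simp
  let ?C = "k * s\<^sup>2 * (1 - l)"
  note chord = quadratic_chord[OF Q_quadratic]
  show False
  proof (cases "0 < ?C")
    case True
    have "0 < ?C * ((y - x) * (z - y) * (z - x))" using True assms by simp
    moreover have "0 \<le> (z - y) * Q l x" "0 \<le> (y - x) * Q l z" using assms z0 by simp_all
    ultimately have "0 < (z - x) * Q l y" using chord[of z x l y] by linarith
    then show False using assms by (simp add: zero_less_mult_iff)
  next
    case False
    have "?C * ((z - y) * (1 - z) * (1 - y)) \<le> 0"
      by (rule mult_nonpos_nonneg) (use False assms in \<open>linarith, simp\<close>)
    moreover have "(1 - z) * Q l y \<le> 0" using assms by (simp add: mult_nonneg_nonpos)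
    moreover have "(z - y) * Q l 1 < 0" using assms Q_1[OF l] by (simp add: mult_pos_neg)
    ultimately have "(1 - y) * Q l z < 0" using chord[of 1 y l z] by linarith
    then show False using assms z0 by (simp add: mult_less_0_iff)
  qed
qed

text \<open>Since \<open>g l\<close> vanishes at 0, the data at \<open>u\<close> and
  \<open>v\<close> yield a point with \<open>Q l\<close> nonnegative followed by one with
  \<open>Q l\<close> nonpositive. From then on \<open>Q l\<close> is negative, so \<open>g l\<close>
  falls strictly after \<open>v\<close>.\<close>

lemma g_stays_negative:
  assumes l: "0 < l" and "0 < u" "u < v" "v < z" "z < 1" "0 \<le> g l u" "g l v \<le> 0"
  shows "g l z < 0"
proof -
  obtain x d where x: "0 < x" "x < u" "0 < d" "g l u - g l 0 = d * Q l x"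
    using g_mvt[of 0 u l] assms by auto
  then have Qx: "0 \<le> Q l x" using assms by (simp add: zero_le_mult_iff)
  obtain y d' where y: "u < y" "y < v" "0 < d'" "g l v - g l u = d' * Q l y"
    using g_mvt[of u v l] assms by auto
  then have "d' * Q l y \<le> 0" using assms by linarith
  then have Qy: "Q l y \<le> 0" using y by (simp add: mult_le_0_iff)
  obtain t d'' where t: "v < t" "t < z" "0 < d''" "g l z - g l v = d'' * Q l t"
    using g_mvt[of v z l] assms by auto
  have "Q l t < 0" by (rule Q_stays_negative[OF l, of x y]) (use x y t Qx Qy assms in auto)
  then have "d'' * Q l t < 0" using t by (simp add: mult_pos_neg)
  then show ?thesis using t assms by linarith
qed

text \<open>The ratio of output to input divergence tends to \<open>s\<^sup>2\<close> at 0. For this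
  multiplier \<open>Q\<close> has no constant term, and its linear coefficient is positive because
  \<open>k > 1\<close>, that is n > 2; so the ratio exceeds its limit somewhere.\<close>

lemma ratio_above_slope_at_0: "\<exists>e. 0 < e \<and> e < 1 \<and> 0 < G (s\<^sup>2) e"
proof -
  define a where "a = (k - 1) * s\<^sup>2 * (1 - s)"
  define c where "c = k * s\<^sup>2 * (1 - s\<^sup>2)"
  have a0: "0 < a" using k2 s0 s1 by (simp add: a_def)
  have Qe: "Q (s\<^sup>2) e = e * (a - c * e)" for e
    unfolding Q_quadratic a_def c_def by algebra
  have "((\<lambda>e. a - c * e) \<longlongrightarrow> a - c * 0) (at_right 0)"
    by (intro tendsto_intros)
  then have "\<forall>\<^sub>F e in at_right 0. 0 < a - c * e"
    using a0 by (intro order_tendstoD(1)) auto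
  then obtain r where r: "0 < r" "\<And>e. 0 < e \<Longrightarrow> e < r \<Longrightarrow> 0 < a - c * e"
    unfolding eventually_at_right_field by auto
  define e where "e = min r (1/2)"
  have e: "0 < e" "e < 1" "e \<le> r" using r by (auto simp: e_def)
  have "0 < g (s\<^sup>2) v" if v: "0 < v" "v < e" for v
  proof -
    obtain z d where z: "0 < z" "z < v" "0 < d" "g (s\<^sup>2) v - g (s\<^sup>2) 0 = d * Q (s\<^sup>2) z"
      using g_mvt[of 0 v "s\<^sup>2"] v e by auto
    moreover have "0 < Q (s\<^sup>2) z" using Qe[of z] r(2)[of z] z v e by simp
    ultimately show ?thesis by simp
  qed
  then have "G (s\<^sup>2) 0 < G (s\<^sup>2) e" using e by (intro G_less) auto
  then show ?thesis using e by auto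
qed

text \<open>Here the constant term \<open>s\<^sup>2 - l\<close> of \<open>Q l\<close> is negative.
  The lemma keeps the maximum of the ratio of divergences away from 0, where the ratio is
  0/0.\<close>

lemma G_negative_near_0:
  assumes l: "s\<^sup>2 < l"
  shows "\<exists>r>0. r < 1 \<and> (\<forall>e. 0 < e \<longrightarrow> e \<le> r \<longrightarrow> G l e < 0)"
proof -
  have "isCont (Q l) 0"
    unfolding Q_def[abs_def] by (intro continuous_intros)
  then have "(Q l \<longlongrightarrow> Q l 0) (at_right 0)"
    by (simp add: isCont_def filterlim_at_split)
  moreover have "Q l 0 < 0" using l by (simp add: Q_def)
  ultimately have "\<forall>\<^sub>F e in at_right 0. Q l e < 0"
    by (rule order_tendstoD(2))
  then obtain r where r: "0 < r" "\<And>e. 0 < e \<Longrightarrow> e < r \<Longrightarrow> Q l e < 0"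
    unfolding eventually_at_right_field by auto
  define q where "q = min r (1/2)"
  have q: "0 < q" "q < 1" "q \<le> r" using r by (auto simp: q_def)
  have neg: "g l v < 0" if v: "0 < v" "v < q" for v
  proof -
    obtain z d where z: "0 < z" "z < v" "0 < d" "g l v - g l 0 = d * Q l z"
      using g_mvt[of 0 v l] v q by auto
    moreover have "Q l z < 0" using r(2)[of z] z v q by simp
    ultimately show ?thesis by (simp add: mult_pos_neg)
  qed
  have "G l e < 0" if "0 < e" "e \<le> q" for e
    using G_greater[of 0 e l] neg that q by auto
  then show ?thesis using q by blast
qed

text \<open>As \<open>e\<close> tends to 1, the term \<open>- ln (1 - e)\<close> makes the slope of
  \<open>X\<close> infinite while the output side stays bounded. So the Lagrangian decreases at the
  end, and no tangent with positive slope touches there.\<close>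

lemma G_exceeds_end:
  assumes l: "0 < l"
  shows "\<exists>e. 0 < e \<and> e < 1 \<and> G l 1 < G l e"
proof -
  have lim: "((\<lambda>e. l * ln (1 + k * e) - s * (ln (1 + k * (s * e)) - ln (1 - s * e))) \<longlongrightarrow>
      l * ln (1 + k * 1) - s * (ln (1 + k * (s * 1)) - ln (1 - s * 1))) (at_left 1)"
    by (intro tendsto_intros) (use scaled_dom[of 1] k2 in auto)
  have "filterlim (\<lambda>e::real. - ln (1 - e)) at_top (at_left 1)"
    by real_asymp
  then have "filterlim (\<lambda>e::real. l * - ln (1 - e)) at_top (at_left 1)"
    by (rule filterlim_tendsto_pos_mult_at_top[OF tendsto_const l])
  from filterlim_tendsto_add_at_top[OF lim this]
  have "\<forall>\<^sub>F e in at_left 1. 0 < l * ln (1 + k * e) - s * (ln (1 + k * (s * e)) - ln (1 - s * e))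
      + l * - ln (1 - e)"
    unfolding filterlim_at_top_dense by blast
  then have "\<forall>\<^sub>F e in at_left 1. g l e < 0"
    by eventually_elim (simp add: g_def m_def algebra_simps)
  then obtain r where r: "r < 1" "\<And>e. r < e \<Longrightarrow> e < 1 \<Longrightarrow> g l e < 0"
    unfolding eventually_at_left_field by auto
  define q where "q = max r (1/2)"
  have "G l 1 < G l q" using r by (intro G_greater) (auto simp: q_def)
  then show ?thesis using r by (intro exI[of _ q]) (auto simp: q_def)
qed

lemma interior_max_g_zero:
  assumes "0 < e" "e < 1" "\<And>e'. e' \<in> {0..1} \<Longrightarrow> G l e' \<le> G l e"
  shows "g l e = 0"
proof -
  have "k / real n * g l e = 0"
  proof (rule DERIV_local_max[OF G_DERIV, of e "min e (1 - e)"])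
    show "\<forall>y. \<bar>e - y\<bar> < min e (1 - e) \<longrightarrow> G l y \<le> G l e"
    proof (intro allI impI)
      fix y assume "\<bar>e - y\<bar> < min e (1 - e)"
      then have "y \<in> {0..1}" by (simp add: abs_if split: if_splits)
      then show "G l y \<le> G l e" by (rule assms(3))
    qed
  qed (use assms in auto)
  then show ?thesis using k2 n3 by auto
qed

text \<open>The multiplier \<open>lc\<close> is the slope of the steepest line from the origin that
  meets the curve of divergence pairs, and \<open>ec\<close> is the parameter of the point of
  contact.\<close>

lemma critical_point:
  obtains ec lc where "0 < ec" "ec < 1" "0 < lc" "G lc ec = 0"
    "\<And>e. e \<in> {0..1} \<Longrightarrow> G lc e \<le> 0"
    "\<And>e. e \<in> {0..1} \<Longrightarrow> G lc e = 0 \<Longrightarrow> e = 0 \<or> e = ec"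
proof -
  \<comment> \<open>This is the slope of the line from the origin to the curve; the sign of
    \<open>G l e\<close> compares it with \<open>l\<close>.\<close>
  define B where "B e = X (s * e) / X e" for e
  have GB: "0 < G l e \<longleftrightarrow> l < B e" "G l e \<le> 0 \<longleftrightarrow> B e \<le> l" "G l e = 0 \<longleftrightarrow> B e = l"
     "G l e < 0 \<longleftrightarrow> B e < l"
    if "0 < e" "e \<le> 1" for l e
    using X_pos[OF that] by (auto simp: G_def B_def field_simps)
  obtain e1 where e1: "0 < e1" "e1 < 1" "s\<^sup>2 < B e1"
    using ratio_above_slope_at_0 GB(1) by auto
  obtain r where r: "0 < r" "r < 1" "\<And>e. 0 < e \<Longrightarrow> e \<le> r \<Longrightarrow> G (B e1) e < 0"
    using G_negative_near_0[OF e1(3)] by auto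
  have contB: "continuous_on {r..1} B"
    unfolding B_def
  proof (intro continuous_on_divide)
    show "continuous_on {r..1} (\<lambda>e. X (s * e))"
      using continuous_on_subset[OF G_continuous[of 0], of "{r..1}"] r by (simp add: G_def[abs_def])
    show "continuous_on {r..1} X"
      by (rule continuous_on_subset[OF X_continuous]) (use r in auto)
    show "\<forall>e\<in>{r..1}. X e \<noteq> 0"
    proof
      fix e assume "e \<in> {r..1}"
      then show "X e \<noteq> 0" using X_pos[of e] r(1) by auto
    qed
  qed
  then obtain ec where ec: "ec \<in> {r..1}" "\<And>e. e \<in> {r..1} \<Longrightarrow> B e \<le> B ec"
    using continuous_attains_sup[of "{r..1}" B] r by force
  have e1r: "r < e1"
    using r(3)[of e1] GB(3)[of e1 "B e1"] e1 by force
  \<comment> \<open>The maximum over the compact part \<open>{r..1}\<close> is global, because to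
    the left of \<open>r\<close> the ratio is below \<open>B e1\<close>.\<close>
  have max: "B e \<le> B ec" if "0 < e" "e \<le> 1" for e
  proof (cases "e \<le> r")
    case True
    then have "B e < B e1" using r(3)[of e] GB(4)[of e "B e1"] that by simp
    also have "B e1 \<le> B ec" using ec e1r e1 by auto
    finally show ?thesis by simp
  qed (use ec that in auto)
  have ec0: "0 < ec" "ec \<le> 1" using ec r by auto
  have "s\<^sup>2 < B ec" using max[of e1] e1 by simp
  then have lc: "0 < B ec" by (smt (verit) zero_le_power2)
  have G0: "G (B ec) ec = 0" using GB(3)[OF ec0] by simp
  have Gle: "G (B ec) e \<le> 0" if "e \<in> {0..1}" for e
    using that GB(2)[of e "B ec"] max[of e] by (cases "e = 0") auto
  have ec1: "ec < 1"
    using G_exceeds_end[OF lc] Gle G0 ec0 by (smt (verit) atLeastAtMost_iff)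
  \<comment> \<open>Two points of contact would give a zero of \<open>g\<close> at \<open>u\<close>
    and, by Rolle, another at some \<open>z\<close> before \<open>v\<close>. After it
    \<open>g\<close> is negative, so \<open>G\<close> would be positive at \<open>z\<close>.\<close>
  have no_pair: False if "0 < u" "u < v" "v \<le> 1" "G (B ec) u = 0" "G (B ec) v = 0" for u v
  proof -
    let ?l = "B ec"
    have gu: "g ?l u = 0"
      by (rule interior_max_g_zero) (use that Gle in auto)
    have "\<exists>z>u. z < v \<and> (G ?l has_real_derivative 0) (at z)"
    proof (rule Rolle)
      show "G ?l differentiable at x" if "u < x" "x < v" for x
        using G_DERIV[of x ?l] that \<open>0 < u\<close> \<open>v \<le> 1\<close> real_differentiable_def by force
    qed (use that continuous_on_subset[OF G_continuous, of "{u..v}"] in auto)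
    then obtain z where z: "u < z" "z < v" "(G ?l has_real_derivative 0) (at z)" by blast
    have gz: "g ?l z = 0"
      using DERIV_unique[OF z(3) G_DERIV] z that k2 n3 by auto
    have "G ?l v < G ?l z"
      by (rule G_greater) (use g_stays_negative[OF lc, of u z] gz gu z that in auto)
    then show False using Gle[of z] z that by auto
  qed
  have "e = 0 \<or> e = ec" if "e \<in> {0..1}" "G (B ec) e = 0" for e
    using no_pair[of e ec] no_pair[of ec e] that G0 ec0
    by (cases "e = 0"; cases e ec rule: linorder_cases) auto
  then show ?thesis using that[OF ec0(1) ec1 lc G0 Gle] by blast
qed

text \<open>Beyond \<open>ec\<close> the tangent slope \<open>l\<close> is smaller than
  \<open>lc\<close>. So \<open>g l\<close> is positive at \<open>ec\<close>, can change sign only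
  once afterwards, and does so at \<open>e\<close>; to the left of \<open>ec\<close> the comparison
  passes through the multiplier \<open>lc\<close>.\<close>

lemma supercritical_point:
  assumes ec: "0 < ec" "G lc ec = 0" and Gle: "\<And>e. e \<in> {0..1} \<Longrightarrow> G lc e \<le> 0" and lc: "0 < lc"
    and e: "ec < e" "e < 1"
  obtains l where "0 < l" "\<And>e'. e' \<in> {0..1} \<Longrightarrow> e' \<noteq> e \<Longrightarrow> G l e' < G l e"
proof -
  \<comment> \<open>The slope of the curve at parameter \<open>e\<close>, the only multiplier for
    which \<open>g l e = 0\<close>.\<close>
  define l where "l = s * m (s * e) / m e"
  have me: "0 < m e" "0 < m ec" using m_pos ec e by auto
  have l0: "0 < l" using scaled_m_pos[of e] me ec e by (simp add: l_def)
  have ge: "g l e = 0" using me by (simp add: g_def l_def)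
  have gc: "g lc ec = 0" by (rule interior_max_g_zero) (use ec e Gle in auto)
  \<comment> \<open>Otherwise \<open>G lc\<close> would rise above its maximum 0 after
    \<open>ec\<close>.\<close>
  have "\<exists>z>ec. z < e \<and> g lc z \<le> 0"
  proof (rule ccontr)
    assume "\<not> ?thesis"
    then have "G lc ec < G lc e" using ec e by (intro G_less) force+
    then show False using Gle[of e] ec e by auto
  qed
  then obtain z where z: "ec < z" "z < e" "g lc z \<le> 0" by auto
  have "g lc e < 0" by (rule g_stays_negative[OF lc, of ec z]) (use z ec e gc in auto)
  moreover have "g lc e = g l e + (l - lc) * m e" by (simp add: g_def algebra_simps)
  ultimately have llc: "l < lc" using ge me by (simp add: mult_less_0_iff)
  have "g l ec = g lc ec + (lc - l) * m ec" by (simp add: g_def algebra_simps)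
  then have glec: "0 < g l ec" using gc llc me by simp
  have up: "0 < g l v" if v: "ec < v" "v < e" for v
    using g_stays_negative[OF l0, of ec v e] v glec ge ec e by force
  have Gup: "G l v < G l e" if "ec \<le> v" "v < e" for v
    by (rule G_less) (use that ec e up in auto)
  have "G l e' < G l e" if "e' \<in> {0..1}" "e' \<noteq> e" for e'
  proof (cases e' ec rule: linorder_cases)
    case less
    \<comment> \<open>Both summands favour \<open>ec\<close> over a smaller argument: the first is
      maximal there and the second increases.\<close>
    have G_shift: "G l v = G lc v + (lc - l) * X v" for v by (simp add: G_def algebra_simps)
    have "(lc - l) * X e' < (lc - l) * X ec"
      using X_strict_mono[of e' ec] less that ec e llc by simp
    then have "G l e' < G l ec"
      unfolding G_shift using Gle[OF that(1)] ec by linarith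
    then show ?thesis using Gup[of ec] e by simp
  next
    case equal then show ?thesis using Gup e by simp
  next
    case greater
    show ?thesis
    proof (cases "e' < e")
      case False
      then show ?thesis
        using g_stays_negative[OF l0, of ec e] that ec e glec ge
        by (intro G_greater) auto
    qed (use greater Gup in simp)
  qed
  then show ?thesis using that l0 by blast
qed


section \<open>Maximizing the Lagrangian over the whole simplex, letter by letter\<close>

text \<open>The share of one letter in \<open>n\<close> times the Lagrangian: if the letter has
  input probability \<open>w / n\<close>, then \<open>1 + s * (w - 1)\<close> is \<open>n\<close>
  times its output probability.\<close>

definition F :: "real \<Rightarrow> real \<Rightarrow> real" where
  "F l w = xlnx (1 + s * (w - 1)) - l * xlnx w"

definition F' :: "real \<Rightarrow> real \<Rightarrow> real" where
  "F' l w = s * (ln (1 + s * (w - 1)) + 1) - l * (ln w + 1)"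

text \<open>Probability vectors, rescaled to mean \<open>1\<close>.\<close>

definition weights :: "('x::finite \<Rightarrow> real) \<Rightarrow> bool" where
  "weights w \<longleftrightarrow> (\<forall>x. 0 \<le> w x) \<and> (\<Sum>x\<in>UNIV. w x) = real n"

text \<open>For \<open>e\<close> in \<open>{0..1}\<close> this is \<open>n\<close> times a row of
  the Hamming channel with parameter \<open>(1 - e) / n\<close>; it runs from the uniform
  distribution at \<open>e = 0\<close> to a point mass at \<open>e = 1\<close>.\<close>

definition peaked :: "real \<Rightarrow> 'x \<Rightarrow> 'x \<Rightarrow> real" where
  "peaked e x0 x = (if x = x0 then 1 + k * e else 1 - e)"

lemma output_dom:
  assumes "0 \<le> w" "w \<le> real n"
  shows "0 < 1 + s * (w - 1)"
proof (cases "s \<ge> 0")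
  case True
  then have "s * - 1 \<le> s * (w - 1)" using assms by (intro mult_left_mono) auto
  then show ?thesis using s1 by linarith
next
  case False
  then have "s * k \<le> s * (w - 1)" using assms n_eq by (intro mult_left_mono_neg) auto
  then show ?thesis using ks by (simp add: mult.commute)
qed

lemma F_DERIV:
  assumes "0 < w" "w \<le> real n"
  shows "(F l has_real_derivative F' l w) (at w)"
proof -
  have "((\<lambda>w. 1 + s * (w - 1)) has_real_derivative s) (at w)"
    by (auto intro!: derivative_eq_intros)
  from DERIV_xlnx[OF this] output_dom[of w] assms
  have "((\<lambda>w. xlnx (1 + s * (w - 1))) has_real_derivative s * (ln (1 + s * (w - 1)) + 1)) (at w)"
    by simp
  moreover have "((\<lambda>w. l * xlnx w) has_real_derivative l * (1 * (ln w + 1))) (at w)"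
    using assms by (intro DERIV_cmult DERIV_xlnx DERIV_ident)
  ultimately show ?thesis
    unfolding F_def[abs_def] F'_def using DERIV_diff by fastforce
qed

text \<open>The form matters: the denominator is positive and the numerator is affine in
  \<open>w\<close>, so the curvature of \<open>F l\<close> changes sign at most once.\<close>

lemma F'_DERIV:
  assumes "0 < w" "w \<le> real n"
  shows "(F' l has_real_derivative
    (s * (s - l) * w - l * (1 - s)) / (w * (1 + s * (w - 1)))) (at w)"
proof -
  have "((\<lambda>w. 1 + s * (w - 1)) has_real_derivative s) (at w)"
    by (auto intro!: derivative_eq_intros)
  from DERIV_ln_compose[OF this] output_dom[of w] assms
  have "((\<lambda>w. ln (1 + s * (w - 1))) has_real_derivative s / (1 + s * (w - 1))) (at w)"
    by simp
  moreover have "(ln has_real_derivative 1 / w) (at w)"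
    using assms by (intro DERIV_ln_divide)
  ultimately have "(F' l has_real_derivative
      s * (s / (1 + s * (w - 1)) + 0) - l * (1 / w + 0)) (at w)"
    unfolding F'_def[abs_def] by (intro DERIV_diff DERIV_cmult DERIV_add DERIV_const)
  moreover have "s * (s / a + 0) - l * (1 / c + 0) = (s * s * c - l * a) / (c * a)"
    if "0 < a" "0 < c" for a c
    using that by (simp add: field_simps)
  ultimately have "(F' l has_real_derivative
      (s * s * w - l * (1 + s * (w - 1))) / (w * (1 + s * (w - 1)))) (at w)"
    using assms output_dom[of w] by simp
  moreover have "s * s * w - l * (1 + s * (w - 1)) = s * (s - l) * w - l * (1 - s)"
    by algebra
  ultimately show ?thesis by simp
qed

lemma F'_mvt:
  assumes "0 < a" "a < b" "b \<le> real n"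
  obtains z d where "a < z" "z < b" "0 < d" "F' l b - F' l a = d * (s * (s - l) * z - l * (1 - s))"
proof -
  have "\<exists>z>a. z < b \<and> F' l b - F' l a =
      (b - a) * ((s * (s - l) * z - l * (1 - s)) / (z * (1 + s * (z - 1))))"
    by (rule MVT2) (use assms F'_DERIV in auto)
  then obtain z where z: "a < z" "z < b" and
    eq: "F' l b - F' l a = (b - a) * ((s * (s - l) * z - l * (1 - s)) / (z * (1 + s * (z - 1))))"
    by blast
  have "0 < (b - a) / (z * (1 + s * (z - 1)))"
    using assms z output_dom[of z] by (intro divide_pos_pos mult_pos_pos) auto
  then show ?thesis using that[OF z] eq by simp
qed

text \<open>If \<open>F' l\<close> does not drop from \<open>a\<close> to \<open>b\<close>, the
  affine numerator of its derivative is nonnegative at some \<open>z\<close> in between. Its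
  constant term is at most 0, so its slope is positive and the numerator is positive beyond
  \<open>z\<close>.\<close>

lemma F'_increasing_zone:
  assumes l: "0 \<le> l" and ab: "0 < a" "a < b" "b \<le> real n" and "F' l a \<le> F' l b"
  obtains z where "0 \<le> z" "z < b" "\<And>u v. z < u \<Longrightarrow> u < v \<Longrightarrow> v \<le> real n \<Longrightarrow> F' l u < F' l v"
proof -
  obtain z d where z: "a < z" "z < b" "0 < d" and
    eq: "F' l b - F' l a = d * (s * (s - l) * z - l * (1 - s))"
    using F'_mvt[OF ab] by metis
  have "0 \<le> d * (s * (s - l) * z - l * (1 - s))"
    using eq assms by linarith
  then have Pz: "0 \<le> s * (s - l) * z - l * (1 - s)"
    using z by (simp add: zero_le_mult_iff)
  have c: "0 < s * (s - l)"
  proof (cases "l = 0")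
    case True
    then show ?thesis using s0 by (simp flip: power2_eq_square)
  next
    case False
    then have "0 < l * (1 - s)" using l s1 by simp
    then have "0 < s * (s - l) * z" using Pz by linarith
    then show ?thesis using z ab by (simp add: zero_less_mult_iff)
  qed
  have "F' l u < F' l v" if uv: "z < u" "u < v" "v \<le> real n" for u v
  proof -
    have "0 < u" using uv z ab by linarith
    then obtain y d where y: "u < y" "y < v" "0 < d" and
      eq: "F' l v - F' l u = d * (s * (s - l) * y - l * (1 - s))"
      using F'_mvt[of u v l] uv by metis
    have "s * (s - l) * z < s * (s - l) * y"
      by (rule mult_strict_left_mono) (use c y uv in auto)
    then have "0 < d * (s * (s - l) * y - l * (1 - s))"
      using Pz y by (intro mult_pos_pos) linarith+
    then show ?thesis using eq by linarith
  qed
  then show ?thesis using that[of z] z ab by simp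
qed

text \<open>Beyond \<open>z\<close> the function \<open>F l\<close> is strictly convex, so two equal
  weights gain by moving apart. The bound \<open>2 * b \<le> real n\<close> keeps the larger one in
  range.\<close>

lemma F_spread_pair:
  assumes z: "0 \<le> z" "z < b" "2 * b \<le> real n"
    and inc: "\<And>u v. z < u \<Longrightarrow> u < v \<Longrightarrow> v \<le> real n \<Longrightarrow> F' l u < F' l v"
  obtains t where "0 < t" "t < b" "F l b + F l b < F l (b + t) + F l (b - t)"
proof
  \<comment> \<open>Half of the distance to \<open>z\<close>, so that \<open>b - t\<close> remains
    in the convex zone.\<close>
  define t where "t = (b - z) / 2"
  have t: "0 < t" "t < b" "z < b - t" "b + t \<le> real n"
    using z by (auto simp: t_def field_simps)
  have "\<exists>u>b. u < b + t \<and> F l (b + t) - F l b = (b + t - b) * F' l u"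
    by (rule MVT2) (use t z F_DERIV in auto)
  moreover have "\<exists>u>b - t. u < b \<and> F l b - F l (b - t) = (b - (b - t)) * F' l u"
    by (rule MVT2) (use t z F_DERIV in auto)
  ultimately obtain u v where uv: "u > b" "u < b + t" "v > b - t" "v < b"
    "F l (b + t) - F l b = t * F' l u" "F l b - F l (b - t) = t * F' l v" by auto
  have "t * F' l v < t * F' l u"
    by (intro mult_strict_left_mono inc) (use uv t in auto)
  then show "F l b + F l b < F l (b + t) + F l (b - t)" using uv by linarith
  show "0 < t" "t < b" using t by auto
qed

lemma F_continuous: "continuous_on {0..real n} (F l)"
proof -
  have "continuous_on {0..real n} (\<lambda>w. 1 + s * (w - 1))"
    by (intro continuous_intros)
  then have "continuous_on {0..real n} (\<lambda>w. xlnx (1 + s * (w - 1)))"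
    by (rule continuous_on_xlnx_compose) (use output_dom in \<open>auto intro: less_imp_le\<close>)
  moreover have "continuous_on {0..real n} xlnx"
    by (rule continuous_on_subset[OF continuous_on_xlnx]) auto
  ultimately show ?thesis
    unfolding F_def[abs_def] by (intro continuous_on_diff continuous_on_mult_left)
qed

text \<open>For positive \<open>l\<close> the derivative of \<open>F l\<close> at \<open>0\<close> is infinite, so moving a little mass onto an
  empty letter always pays off.\<close>

lemma F_leave_zero:
  assumes l: "0 < l" and c: "0 < c" "c \<le> real n"
  obtains t where "0 < t" "t < c" "F l 0 + F l c < F l t + F l (c - t)"
proof -
  have lim: "((\<lambda>t. s * (ln (1 + s * (t - 1)) + 1) - l - F' l (c - t)) \<longlongrightarrow>
       s * (ln (1 + s * (0 - 1)) + 1) - l - F' l (c - 0)) (at_right 0)"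
    unfolding F'_def by (intro tendsto_intros) (use s1 c output_dom[of c] in auto)
  have "filterlim (\<lambda>t::real. - ln t) at_top (at_right 0)"
    by real_asymp
  then have "filterlim (\<lambda>t::real. l * - ln t) at_top (at_right 0)"
    by (rule filterlim_tendsto_pos_mult_at_top[OF tendsto_const l])
  from filterlim_tendsto_add_at_top[OF lim this]
  have "\<forall>\<^sub>F t in at_right 0. 0 < s * (ln (1 + s * (t - 1)) + 1) - l - F' l (c - t) + l * - ln t"
    unfolding filterlim_at_top_dense by blast
  then have "\<forall>\<^sub>F t in at_right 0. F' l (c - t) < F' l t"
    by eventually_elim (simp add: F'_def algebra_simps)
  then obtain r where r: "0 < r" "\<And>t. 0 < t \<Longrightarrow> t < r \<Longrightarrow> F' l (c - t) < F' l t"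
    unfolding eventually_at_right_field by auto
  define t where "t = min r c / 2"
  have t: "0 < t" "t < c" "t < r" using r c by (auto simp: t_def)
  have "F l 0 + F l (c - 0) < F l t + F l (c - t)"
  proof (rule DERIV_pos_imp_increasing_open[OF t(1), of "\<lambda>t. F l t + F l (c - t)"])
    fix x assume x: "0 < x" "x < t"
    have "((\<lambda>t. c - t) has_real_derivative - 1) (at x)"
      by (auto intro!: derivative_eq_intros)
    then have "((\<lambda>t. F l (c - t)) has_real_derivative F' l (c - x) * - 1) (at x)"
      by (intro DERIV_chain2[where f = "F l" and g = "\<lambda>t. c - t"] F_DERIV) (use x t c in auto)
    then have "((\<lambda>t. F l t + F l (c - t)) has_real_derivative F' l x + F' l (c - x) * - 1) (at x)"
      by (intro DERIV_add F_DERIV) (use x t c in auto)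
    moreover have "0 < F' l x + F' l (c - x) * - 1" using r(2)[of x] x t by simp
    ultimately show "\<exists>y. ((\<lambda>t. F l t + F l (c - t)) has_real_derivative y) (at x) \<and> 0 < y"
      by blast
  next
    have "continuous_on {0..t} (\<lambda>x. c - x)" by (intro continuous_intros)
    then have "continuous_on {0..t} (\<lambda>x. F l (c - x))"
      by (rule continuous_on_compose2[OF F_continuous]) (use t c in auto)
    moreover have "continuous_on {0..t} (F l)"
      by (rule continuous_on_subset[OF F_continuous]) (use t c in auto)
    ultimately show "continuous_on {0..t} (\<lambda>t. F l t + F l (c - t))"
      by (intro continuous_on_add)
  qed
  then show ?thesis using that[OF t(1,2)] by simp
qed

lemma sum_peaked:
  fixes x0 :: "'x::finite"
  assumes "CARD('x) = n"
  shows "(\<Sum>x\<in>UNIV. f (peaked e x0 x)) = f (1 + k * e) + k * f (1 - e)"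
proof -
  have "(\<Sum>x\<in>UNIV. f (peaked e x0 x)) = f (1 + k * e) + (\<Sum>x\<in>UNIV - {x0}. f (peaked e x0 x))"
    by (subst sum.remove[of UNIV x0]) (auto simp: peaked_def)
  also have "(\<Sum>x\<in>UNIV - {x0}. f (peaked e x0 x)) = (\<Sum>x\<in>UNIV - {x0}. f (1 - e))"
    by (intro sum.cong) (auto simp: peaked_def)
  also have "\<dots> = k * f (1 - e)"
    using assms n3 by (simp add: card_Diff_singleton k_def of_nat_diff)
  finally show ?thesis .
qed

lemma sum_F_peaked:
  fixes x0 :: "'x::finite"
  assumes "CARD('x) = n"
  shows "(\<Sum>x\<in>UNIV. F l (peaked e x0 x)) = real n * G l e"
proof -
  have "1 + s * (1 + k * e - 1) = 1 + k * (s * e)" "1 + s * (1 - e - 1) = 1 - s * e"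
    by algebra+
  then have "F l (1 + k * e) = xlnx (1 + k * (s * e)) - l * xlnx (1 + k * e)"
    and "F l (1 - e) = xlnx (1 - s * e) - l * xlnx (1 - e)"
    by (simp_all only: F_def)
  then show ?thesis
    using n3 by (simp only: sum_peaked[OF assms]) (simp add: G_def X_def field_simps)
qed

lemma sum_two_letters:
  fixes f :: "'x::finite \<Rightarrow> real"
  assumes "x \<noteq> y"
  shows "(\<Sum>u\<in>UNIV. f u) = f x + f y + (\<Sum>u\<in>UNIV - {x, y}. f u)"
proof -
  have "UNIV - {x} - {y} = UNIV - {x, y}" by auto
  then show ?thesis
    using assms sum.remove[of UNIV x f] sum.remove[of "UNIV - {x}" y f] by simp
qed

text \<open>Moving mass \<open>t\<close> from \<open>y\<close> to \<open>x\<close> leaves the total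
  unchanged, so a maximum over all weights passes every such two-letter test.\<close>

lemma maximum_pair:
  fixes w :: "'x::finite \<Rightarrow> real"
  assumes w: "weights w"
    and max: "\<And>v :: 'x \<Rightarrow> real. weights v \<Longrightarrow> (\<Sum>x\<in>UNIV. F l (v x)) \<le> (\<Sum>x\<in>UNIV. F l (w x))"
    and xy: "x \<noteq> y" and t: "0 \<le> w x + t" "0 \<le> w y - t"
  shows "F l (w x + t) + F l (w y - t) \<le> F l (w x) + F l (w y)"
proof -
  define v where "v = w(x := w x + t, y := w y - t)"
  have rest: "(\<Sum>u\<in>UNIV - {x, y}. f (v u)) = (\<Sum>u\<in>UNIV - {x, y}. f (w u))" for f :: "real \<Rightarrow> real"
    by (intro sum.cong) (auto simp: v_def)
  have vxy: "v x = w x + t" "v y = w y - t" using xy by (auto simp: v_def)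
  have "(\<Sum>u\<in>UNIV. v u) = real n"
    using sum_two_letters[OF xy, of v] sum_two_letters[OF xy, of w] rest[of "\<lambda>z. z"] w vxy
    by (simp add: weights_def)
  moreover have "0 \<le> v u" for u
    using w t by (simp add: v_def weights_def)
  ultimately have "(\<Sum>x\<in>UNIV. F l (v x)) \<le> (\<Sum>x\<in>UNIV. F l (w x))"
    by (intro max) (simp add: weights_def)
  then show ?thesis
    using sum_two_letters[OF xy, of "\<lambda>u. F l (v u)"] sum_two_letters[OF xy, of "\<lambda>u. F l (w u)"]
      rest[of "F l"] vxy by simp
qed

text \<open>At a maximum \<open>F' l\<close> agrees on all letters of positive weight. As
  \<open>F' l\<close> first falls and then rises, at most two weights occur, and the larger one lies
  in the convex zone, where it cannot be shared by two letters.\<close>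

lemma maximum_peaked:
  fixes w :: "'x::finite \<Rightarrow> real"
  assumes card: "CARD('x) = n" and l: "0 \<le> l"
    and wt: "weights w"
    and max: "\<And>v :: 'x \<Rightarrow> real. weights v \<Longrightarrow> (\<Sum>x\<in>UNIV. F l (v x)) \<le> (\<Sum>x\<in>UNIV. F l (w x))"
  shows "\<exists>e\<in>{0..1}. \<exists>x0. w = peaked e x0"
proof -
  have pair: "F l (w x + t) + F l (w y - t) \<le> F l (w x) + F l (w y)"
    if "x \<noteq> y" "0 \<le> w x + t" "0 \<le> w y - t" for x y t
    by (rule maximum_pair[OF wt _ that]) (rule max)
  have w: "0 \<le> w x" "(\<Sum>x\<in>UNIV. w x) = real n" for x
    using wt by (simp_all add: weights_def)
  have le: "w x + w y \<le> real n" if "x \<noteq> y" for x y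
    using sum_two_letters[OF that, of w] w by (simp add: sum_nonneg)
  have "\<exists>y. y \<noteq> x" for x :: 'x
  proof (rule ccontr)
    assume "\<nexists>y. y \<noteq> x"
    then have "UNIV = {x}" by auto
    then have "CARD('x) = card {x}" by simp
    then show False using card n3 by simp
  qed
  then have len: "w x \<le> real n" for x
    using le w(1) by (smt (verit))
  \<comment> \<open>First-order condition for a transfer of mass between two letters, which can go
    either way because both weights are positive.\<close>
  have stat: "F' l (w x) = F' l (w y)" if xy: "x \<noteq> y" "0 < w x" "0 < w y" for x y
  proof -
    have d1: "((\<lambda>t. F l (w x + t)) has_real_derivative F' l (w x + 0) * 1) (at 0)"
      by (rule DERIV_chain2[where f = "F l" and g = "\<lambda>t. w x + t"])
        (use xy len in \<open>auto intro!: F_DERIV derivative_eq_intros\<close>)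
    have d2: "((\<lambda>t. F l (w y - t)) has_real_derivative F' l (w y - 0) * - 1) (at 0)"
      by (rule DERIV_chain2[where f = "F l" and g = "\<lambda>t. w y - t"])
        (use xy len in \<open>auto intro!: F_DERIV derivative_eq_intros\<close>)
    have "F' l (w x + 0) * 1 + F' l (w y - 0) * - 1 = 0"
    proof (rule DERIV_local_max[OF DERIV_add[OF d1 d2], of "min (w x) (w y)"])
      show "0 < min (w x) (w y)" using xy by simp
      show "\<forall>t. \<bar>0 - t\<bar> < min (w x) (w y) \<longrightarrow>
          F l (w x + t) + F l (w y - t) \<le> F l (w x + 0) + F l (w y - 0)"
        using pair[OF xy(1)] by (simp add: abs_less_iff)
    qed
    then show ?thesis by simp
  qed
  have no_equal_pair: False
    if xy: "x \<noteq> y" "w x = w y" and z: "0 \<le> z" "z < w y"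
      and inc: "\<And>u v. z < u \<Longrightarrow> u < v \<Longrightarrow> v \<le> real n \<Longrightarrow> F' l u < F' l v" for x y z
  proof -
    have "2 * w y \<le> real n" using le[OF xy(1)] xy by simp
    from F_spread_pair[OF z this inc] obtain t where
      t: "0 < t" "t < w y" "F l (w y) + F l (w y) < F l (w y + t) + F l (w y - t)" by blast
    then show False using pair[OF xy(1), of t] xy by simp
  qed
  have some_pos: "\<exists>x. 0 < w x"
  proof (rule ccontr)
    assume "\<nexists>x. 0 < w x"
    then have "(\<Sum>x\<in>UNIV. w x) \<le> 0" by (intro sum_nonpos) (simp add: not_less)
    then show False using w n3 by simp
  qed
  show ?thesis
  proof (cases "l = 0")
    case True
    \<comment> \<open>Without a multiplier empty letters are possible, but now \<open>F' l\<close>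
      increases everywhere, so all mass sits on a single letter.\<close>
    have ss: "0 < s * s" using s0 not_real_square_gt_zero by blast
    have inc: "F' l u < F' l v" if uv: "0 < u" "u < v" "v \<le> real n" for u v
    proof -
      obtain z d where "u < z" "0 < d" "F' l v - F' l u = d * (s * (s - l) * z - l * (1 - s))"
        using F'_mvt[OF uv] by metis
      moreover from this have "0 < d * (s * s * z)"
        using uv ss by (intro mult_pos_pos[of d] mult_pos_pos[of "s * s"]) auto
      ultimately show ?thesis using True by simp
    qed
    obtain x0 where x0: "0 < w x0" using some_pos by blast
    have rest: "w y = 0" if y: "y \<noteq> x0" for y
    proof (rule ccontr)
      assume "w y \<noteq> 0"
      then have wy: "0 < w y" using w(1)[of y] by simp
      have "F' l (w y) = F' l (w x0)" by (rule stat) (use y wy x0 in auto)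
      then have "w y = w x0"
        using inc[OF wy _ len, of x0] inc[OF x0 _ len, of y] by (metis linorder_neqE less_irrefl)
      then show False using no_equal_pair[OF y _ order_refl x0 inc] by blast
    qed
    then have "(\<Sum>x\<in>UNIV - {x0}. w x) = 0" by simp
    then have "w x0 = real n" using w(2) sum.remove[of UNIV x0 w] by simp
    then have "w = peaked 1 x0"
      using rest by (auto simp: peaked_def n_eq)
    then show ?thesis by force
  next
    case False
    then have l: "0 < l" using l by simp
    have pos: "0 < w x" for x
    proof (rule ccontr)
      assume "\<not> 0 < w x"
      then have wx: "w x = 0" using w(1)[of x] by simp
      obtain y where y: "0 < w y" using some_pos by blast
      then have xy: "x \<noteq> y" using wx by auto
      from F_leave_zero[OF l y len] obtain t where
        "0 < t" "t < w y" "F l 0 + F l (w y) < F l t + F l (w y - t)" by blast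
      then show False using pair[OF xy, of t] wx by simp
    qed
    show ?thesis
    proof (cases "\<exists>x y. w x < w y")
      case False
      then have all_eq: "w x = w y" for x y by (metis linorder_cases)
      then have "(\<Sum>x\<in>UNIV. w x) = (\<Sum>x\<in>(UNIV :: 'x set). w undefined)"
        by (intro sum.cong) (auto intro: all_eq)
      then have "w undefined = 1" using w(2) card n3 by simp
      then have "w = peaked 0 undefined"
        using all_eq[of _ undefined] by (simp add: peaked_def fun_eq_iff)
      then show ?thesis by force
    next
      case True
      then obtain x y where xy: "w x < w y" by blast
      \<comment> \<open>Equal derivatives at the two smaller weights put the middle one into the
        zone where \<open>F' l\<close> increases strictly, so the largest cannot have the same
        derivative.\<close>
      have three: False if pqr: "w p < w q" "w q < w r" for p q r
      proof -
        have pq: "F' l (w p) = F' l (w q)" and qr: "F' l (w q) = F' l (w r)"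
          using pqr pos by (auto intro!: stat)
        obtain z where "z < w q" "\<And>u v. z < u \<Longrightarrow> u < v \<Longrightarrow> v \<le> real n \<Longrightarrow> F' l u < F' l v"
          using F'_increasing_zone[OF less_imp_le[OF l] pos pqr(1) len eq_refl[OF pq]] by blast
        then show False using qr pqr len[of r] by fastforce
      qed
      have rest: "w y' = w x" if y': "y' \<noteq> y" for y'
      proof (rule ccontr)
        assume ne: "w y' \<noteq> w x"
        have "w y' = w y"
          using ne three[of y' x y] three[of x y' y] three[of x y y'] xy
          by (meson linorder_neqE)
        moreover have "F' l (w x) = F' l (w y)"
          using xy pos by (auto intro!: stat)
        then obtain z where "0 \<le> z" "z < w y"
          "\<And>u v. z < u \<Longrightarrow> u < v \<Longrightarrow> v \<le> real n \<Longrightarrow> F' l u < F' l v"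
          using F'_increasing_zone[OF less_imp_le[OF l] pos xy len eq_refl] by blast
        ultimately show False using no_equal_pair[OF y'] by blast
      qed
      \<comment> \<open>The common weight of all letters but \<open>y\<close> is
        \<open>1 - e\<close>, and the total then fixes the weight of \<open>y\<close>.\<close>
      define e where "e = 1 - w x"
      have "(\<Sum>u\<in>UNIV - {y}. w u) = (\<Sum>u\<in>UNIV - {y}. w x)"
        using rest by (intro sum.cong) auto
      also have "\<dots> = k * w x"
        using card n3 by (simp add: card_Diff_singleton k_def of_nat_diff)
      finally have wy: "w y = 1 + k * e"
        using w(2) sum.remove[of UNIV y w] by (simp add: e_def n_eq algebra_simps)
      have "w = peaked e y"
        using rest wy by (auto simp: peaked_def e_def fun_eq_iff)
      moreover have "0 \<le> e"
      proof (rule ccontr)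
        assume "\<not> 0 \<le> e"
        then have "k * e < 0" "e < 0" using k2 by (auto simp: mult_pos_neg)
        then show False using xy wy by (simp add: e_def)
      qed
      moreover have "e \<le> 1" using w(1)[of x] by (simp add: e_def)
      ultimately show ?thesis by auto
    qed
  qed
qed

lemma weights_le:
  assumes "weights w"
  shows "w x \<le> real n"
  using assms member_le_sum[of x UNIV w] by (auto simp: weights_def)

text \<open>The simplex is carried over to \<open>real ^ 'x\<close>, a Euclidean space, where closed
  and bounded sets are compact.\<close>

lemma compact_weights: "compact {w :: real ^ 'x::finite. weights (($) w)}" (is "compact ?S")
proof -
  have "closed ?S"
    unfolding weights_def
    by (intro closed_Collect_conj closed_Collect_all closed_Collect_le closed_Collect_eq
        continuous_intros)
  moreover have "bounded ?S"
  proof (rule boundedI)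
    fix w assume w: "w \<in> ?S"
    have "norm w \<le> (\<Sum>x\<in>UNIV. \<bar>w $ x\<bar>)" by (rule norm_le_l1_cart)
    also have "\<dots> = real n" using w by (simp add: weights_def)
    finally show "norm w \<le> real n" .
  qed
  ultimately show ?thesis by (simp add: compact_eq_bounded_closed)
qed

lemma maximum_exists:
  assumes card: "CARD('x::finite) = n"
  obtains w :: "'x::finite \<Rightarrow> real" where "weights w"
    "\<And>v :: 'x::finite \<Rightarrow> real. weights v \<Longrightarrow> (\<Sum>x\<in>UNIV. F l (v x)) \<le> (\<Sum>x\<in>UNIV. F l (w x))"
proof -
  define S where "S = {w :: real ^ 'x. weights (($) w)}"
  have le: "0 \<le> w $ x" "w $ x \<le> real n" if "w \<in> S" for w x
    using that weights_le[of "($) w" x] by (auto simp: S_def weights_def)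
  have "compact S" unfolding S_def by (rule compact_weights)
  moreover have "(\<chi> x. 1) \<in> S" using card by (simp add: S_def weights_def)
  then have "S \<noteq> {}" by blast
  moreover have "continuous_on S (\<lambda>w. \<Sum>x\<in>UNIV. F l (w $ x))"
  proof (intro continuous_on_sum)
    fix x
    have "continuous_on S (\<lambda>w. w $ x)" by (intro continuous_intros)
    then show "continuous_on S (\<lambda>w. F l (w $ x))"
      by (rule continuous_on_compose2[OF F_continuous]) (use le in auto)
  qed
  ultimately obtain w where w: "w \<in> S"
    "\<And>v. v \<in> S \<Longrightarrow> (\<Sum>x\<in>UNIV. F l (v $ x)) \<le> (\<Sum>x\<in>UNIV. F l (w $ x))"
    using continuous_attains_sup by metis
  have "(\<Sum>x\<in>UNIV. F l (v x)) \<le> (\<Sum>x\<in>UNIV. F l (w $ x))"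
    if "weights v" for v :: "'x \<Rightarrow> real"
    using w(2)[of "\<chi> x. v x"] that by (simp add: S_def vec_lambda_inverse)
  then show ?thesis using that[of "\<lambda>x. w $ x"] w(1) by (simp add: S_def weights_def)
qed

text \<open>Some maximizer exists and every maximizer is peaked, so a bound on the one-parameter
  family bounds the simplex. A vector attaining the bound is itself a maximizer.\<close>

lemma simplex_bound:
  fixes w :: "'x::finite \<Rightarrow> real"
  assumes card: "CARD('x) = n" and l: "0 \<le> l"
    and M: "\<And>e. e \<in> {0..1} \<Longrightarrow> G l e \<le> M"
    and w: "weights w"
  shows "(\<Sum>x\<in>UNIV. F l (w x)) \<le> real n * M"
    and "(\<Sum>x\<in>UNIV. F l (w x)) = real n * M \<Longrightarrow> \<exists>e\<in>{0..1}. \<exists>x0. w = peaked e x0 \<and> G l e = M"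
proof -
  have *: "(\<Sum>x\<in>UNIV. F l (v x)) \<le> real n * M"
    if v: "weights v" for v :: "'x \<Rightarrow> real"
  proof -
    obtain u :: "'x \<Rightarrow> real" where u: "weights u"
      "\<And>v :: 'x \<Rightarrow> real. weights v \<Longrightarrow> (\<Sum>x\<in>UNIV. F l (v x)) \<le> (\<Sum>x\<in>UNIV. F l (u x))"
      using maximum_exists[OF card] by metis
    obtain e x0 where "e \<in> {0..1}" "u = peaked e x0" using maximum_peaked[OF card l u] by blast
    then have "(\<Sum>x\<in>UNIV. F l (u x)) \<le> real n * M"
      using M sum_F_peaked[OF card] by (simp add: mult_left_mono)
    then show ?thesis using u(2)[OF v] by linarith
  qed
  show "(\<Sum>x\<in>UNIV. F l (w x)) \<le> real n * M" by (rule *[OF w])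
  assume eq: "(\<Sum>x\<in>UNIV. F l (w x)) = real n * M"
  obtain e x0 where e: "e \<in> {0..1}" "w = peaked e x0"
    using maximum_peaked[OF card l w] * eq by metis
  then have "real n * G l e = real n * M" using eq sum_F_peaked[OF card] by simp
  then show "\<exists>e\<in>{0..1}. \<exists>x0. w = peaked e x0 \<and> G l e = M" using e n3 by auto
qed

end

section \<open>Finite sums for mutual information and mixtures\<close>

text \<open>Outside the supports the joint probability is 0, so the ranges of summation may be
  enlarged to convenient finite sets. The sum over the second variable comes first, ready for
  averaging over \<open>t\<close>.\<close>

lemma mutual_info_sum:
  assumes b: "1 < b" and fin: "finite (set_pmf M)"
    and S: "finite S" "U ` set_pmf M \<subseteq> S" and T: "finite T" "V ` set_pmf M \<subseteq> T"
  shows "mutual_info b M U V =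
    (\<Sum>v\<in>T. \<Sum>u\<in>S. pmf (map_pmf (\<lambda>w. (U w, V w)) M) (u, v) *
       log b (pmf (map_pmf (\<lambda>w. (U w, V w)) M) (u, v) / (pmf (map_pmf U M) u * pmf (map_pmf V M) v)))"
proof -
  let ?J = "map_pmf (\<lambda>w. (U w, V w)) M"
  let ?f = "\<lambda>(u, v). pmf ?J (u, v) * log b (pmf ?J (u, v) / (pmf (map_pmf U M) u * pmf (map_pmf V M) v))"
  have "mutual_info b M U V = sum ?f (U ` set_pmf M \<times> V ` set_pmf M)"
    by (rule mutual_info_finite[OF b fin])
  also have "\<dots> = sum ?f (S \<times> T)"
  proof (rule sum.mono_neutral_left)
    show "\<forall>z \<in> S \<times> T - U ` set_pmf M \<times> V ` set_pmf M. ?f z = 0"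
    proof
      fix z assume z: "z \<in> S \<times> T - U ` set_pmf M \<times> V ` set_pmf M"
      then have "z \<notin> set_pmf ?J" by auto
      then have "pmf ?J z = 0" unfolding set_pmf_iff by blast
      then show "?f z = 0" by (simp add: case_prod_beta)
    qed
  qed (use S T in auto)
  also have "\<dots> = (\<Sum>u\<in>S. \<Sum>v\<in>T. ?f (u, v))"
    by (simp add: sum.cartesian_product)
  also have "\<dots> = (\<Sum>v\<in>T. \<Sum>u\<in>S. ?f (u, v))"
    by (rule sum.swap)
  finally show ?thesis by simp
qed

lemma pmf_bind_uniform:
  fixes f :: "'x::finite \<Rightarrow> 'y pmf"
  shows "pmf (bind_pmf (pmf_of_set UNIV) f) y = (\<Sum>x\<in>UNIV. pmf (f x) y) / real CARD('x)"
  by (simp add: pmf_bind integral_pmf_of_set)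

lemma pmf_bind_finite:
  fixes p :: "'x::finite pmf"
  shows "pmf (bind_pmf p f) y = (\<Sum>x\<in>UNIV. pmf p x * pmf (f x) y)"
  by (simp add: pmf_bind integral_measure_pmf_real[of UNIV] mult.commute)

lemma finite_pmf_exists:
  fixes f :: "'x::finite \<Rightarrow> real"
  assumes "\<And>x. 0 \<le> f x" "(\<Sum>x\<in>UNIV. f x) = 1"
  obtains p where "\<And>x. pmf p x = f x"
proof
  have "(\<integral>\<^sup>+x. ennreal (f x) \<partial>count_space UNIV) = ennreal (\<Sum>x\<in>UNIV. f x)"
    using assms(1) by (simp only: nn_integral_count_space_finite[OF finite] sum_ennreal)
  then show "pmf (embed_pmf f) x = f x" for x
    using assms by (subst pmf_embed_pmf) auto
qed

section \<open>Both informations as averages of posterior divergences\<close>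

locale hamming_bottleneck = hamming_gain n s for n s +
  fixes b \<alpha> :: real and V :: "'x::finite \<Rightarrow> 'x pmf"
  assumes b1: "1 < b" and card: "CARD('x) = n"
    and s_eq: "s = 1 - real n * \<alpha>" and \<alpha>: "0 \<le> \<alpha>" "(real n - 1) * \<alpha> \<le> 1"
    and V_eq: "V = hamming_channel \<alpha>"
begin

text \<open>Thanks to the scaling to mean 1, the divergence in nats of \<open>w / n\<close> from the
  uniform distribution is a plain average of \<open>xlnx (w x)\<close>.\<close>

definition D :: "('x \<Rightarrow> real) \<Rightarrow> real" where
  "D w = (\<Sum>x\<in>UNIV. xlnx (w x)) / real n"

definition E :: "('x \<Rightarrow> real) \<Rightarrow> real" where
  "E w = (\<Sum>x\<in>UNIV. xlnx (1 + s * (w x - 1))) / real n"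

text \<open>The output distribution for uniform input. Applied to a product of channels it gives the
  joint distribution of their outputs.\<close>

definition mass :: "('x \<Rightarrow> 't pmf) \<Rightarrow> 't \<Rightarrow> real" where
  "mass W t = (\<Sum>x\<in>UNIV. pmf (W x) t) / real n"

text \<open>The posterior of \<open>X\<close> given \<open>T = t\<close>, scaled to mean value \<open>1\<close>.\<close>

definition post :: "('x \<Rightarrow> 't pmf) \<Rightarrow> 't \<Rightarrow> 'x \<Rightarrow> real" where
  "post W t x = pmf (W x) t / mass W t"

abbreviation unif :: "'x pmf" where "unif \<equiv> pmf_of_set UNIV"

lemma n_pos: "0 < real n" and lnb_pos: "0 < ln b"
  using n3 b1 by auto

text \<open>Splitting the channel into a constant and a diagonal part makes the scaled output weight
  \<open>1 + s * (w - 1)\<close>.\<close>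

lemma pmf_V: "pmf (V x) y = \<alpha> + (if x = y then s else 0)"
  unfolding V_eq using \<alpha> by (subst pmf_hamming_channel) (simp_all add: card s_eq algebra_simps)

lemma F_sum: "(\<Sum>x\<in>UNIV. F l (w x)) = real n * (E w - l * D w)"
  using n_pos by (simp add: F_def E_def D_def sum_subtractf sum_distrib_left field_simps)

lemma D_peaked: "D (peaked e x0) = X e"
  by (simp add: D_def X_def sum_peaked[OF card])

lemma E_peaked: "E (peaked e x0) = X (s * e)"
  using F_sum[of 0 "peaked e x0"] sum_F_peaked[OF card, of 0 e x0] n_pos by (simp add: G_def)

lemma peaked_0: "peaked 0 x0 = (\<lambda>_. 1)"
  by (auto simp: peaked_def)

lemma D_one [simp]: "D (\<lambda>_. 1) = 0" and E_one [simp]: "E (\<lambda>_. 1) = 0"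
  by (simp_all add: D_def E_def)

text \<open>This also holds for letters of mass 0: all their transition probabilities vanish, so the
  value of the division by 0 in \<open>post\<close> does no harm.\<close>

lemma pmf_posterior:
  "pmf (W x) t = mass W t * post W t x"
proof (cases "mass W t = 0")
  case True
  then have "(\<Sum>x\<in>UNIV. pmf (W x) t) = 0" using n_pos by (simp add: mass_def)
  then have "pmf (W x) t = 0" by (subst (asm) sum_nonneg_eq_0_iff) auto
  then show ?thesis using True by simp
qed (simp add: post_def)

lemma mass_nonneg: "0 \<le> mass W t"
  by (simp add: mass_def sum_nonneg)

lemma weights_post:
  assumes "0 < mass W t"
  shows "weights (post W t)"
proof -
  have "(\<Sum>x\<in>UNIV. post W t x) = (real n * mass W t) / mass W t"
    unfolding post_def sum_divide_distrib[symmetric] using n_pos by (simp add: mass_def)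
  then show ?thesis using assms by (simp add: weights_def post_def)
qed

lemma sum_pmf_channel: "channel_into A W \<Longrightarrow> (\<Sum>t\<in>A. pmf (W x) t) = 1"
  by (intro sum_pmf_eq_1) (auto simp: channel_into_def)

lemma sum_mass:
  assumes "channel_into A W"
  shows "(\<Sum>t\<in>A. mass W t) = 1"
proof -
  have "(\<Sum>t\<in>A. mass W t) = (\<Sum>x\<in>UNIV. \<Sum>t\<in>A. pmf (W x) t) / real n"
    unfolding mass_def sum_divide_distrib[symmetric] by (subst sum.swap) simp
  then show ?thesis using sum_pmf_channel[OF assms] card n_pos by simp
qed

lemma set_markov_joint:
  assumes "channel_into A W"
  shows "set_pmf (markov_joint unif V W) \<subseteq> UNIV \<times> UNIV \<times> A"
  using assms by (auto simp: markov_joint_def channel_into_def)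

lemma markov_joint_X: "map_pmf (\<lambda>(y, x, t). x) (markov_joint unif V W) = unif"
  by (simp add: markov_joint_def map_bind_pmf bind_return_pmf')

lemma markov_joint_Y: "map_pmf (\<lambda>(y, x, t). y) (markov_joint unif V W) = bind_pmf unif V"
  by (simp add: markov_joint_def map_bind_pmf bind_return_pmf')

lemma markov_joint_T: "map_pmf (\<lambda>(y, x, t). t) (markov_joint unif V W) = bind_pmf unif W"
  by (simp add: markov_joint_def map_bind_pmf bind_return_pmf')

lemma markov_joint_XT:
  "map_pmf (\<lambda>z. ((\<lambda>(y, x, t). x) z, (\<lambda>(y, x, t). t) z)) (markov_joint unif V W) =
     bind_pmf unif (\<lambda>x. pair_pmf (return_pmf x) (W x))"
  by (simp add: markov_joint_def map_bind_pmf pair_pmf_def bind_return_pmf)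

lemma markov_joint_YT:
  "map_pmf (\<lambda>z. ((\<lambda>(y, x, t). y) z, (\<lambda>(y, x, t). t) z)) (markov_joint unif V W) =
     bind_pmf unif (\<lambda>x. pair_pmf (V x) (W x))"
  by (simp add: markov_joint_def map_bind_pmf pair_pmf_def)

lemma pmf_X: "pmf unif x = 1 / real n"
  by (simp add: card)

lemma pmf_T: "pmf (bind_pmf unif W) t = mass W t"
  by (simp add: pmf_bind_uniform mass_def card)

lemma mass_V: "mass V y = 1 / real n"
proof -
  have "(\<Sum>x\<in>UNIV. pmf (V x) y) = 1"
    using s_eq card by (simp add: pmf_V sum.distrib)
  then show ?thesis by (simp add: mass_def)
qed

lemma mass_XT: "mass (\<lambda>x. pair_pmf (return_pmf x) (W x)) (x, t) =
    mass W t * (1 / real n) * post W t x"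
proof -
  have "(\<Sum>x'\<in>UNIV. pmf (pair_pmf (return_pmf x') (W x')) (x, t)) =
      (\<Sum>x'\<in>UNIV. if x' = x then pmf (W x) t else 0)"
    by (intro sum.cong) (auto simp: pmf_pair pmf_return)
  then show ?thesis
    using pmf_posterior[of W x t] by (simp add: mass_def)
qed

lemma mass_YT: "mass (\<lambda>x. pair_pmf (V x) (W x)) (y, t) =
    mass W t * (1 / real n) * (1 + s * (post W t y - 1))"
proof -
  have "(\<Sum>x\<in>UNIV. pmf (pair_pmf (V x) (W x)) (y, t)) =
      (\<Sum>x\<in>UNIV. \<alpha> * pmf (W x) t + (if x = y then s * pmf (W y) t else 0))"
    by (intro sum.cong) (auto simp: pmf_pair pmf_V algebra_simps)
  also have "\<dots> = \<alpha> * (real n * mass W t) + s * pmf (W y) t"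
    using n_pos by (simp add: sum.distrib sum_distrib_left[symmetric] mass_def)
  also have "\<dots> = mass W t * (1 + s * (post W t y - 1))"
    unfolding pmf_posterior[of W y t] s_eq by algebra
  finally show ?thesis by (simp add: mass_def)
qed

text \<open>The shape \<open>c * (1 / real n) * z\<close> is that of the joint probabilities in
  \<open>mass_XT\<close> and \<open>mass_YT\<close>; dividing by the marginals leaves
  \<open>z\<close> under the logarithm.\<close>

lemma entropy_term:
  "c * (1 / real n) * z * log b (c * (1 / real n) * z / (1 / real n * c)) = c * (xlnx z / real n) / ln b"
  using n_pos by (cases "c = 0") (auto simp: log_def xlnx_def)

lemma info_XT_eq:
  assumes A: "channel_into A W"
  shows "info_XT b unif V W = (\<Sum>t\<in>A. mass W t * D (post W t)) / ln b"
proof -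
  have fin: "finite (set_pmf (markov_joint unif V W))"
    by (rule finite_subset[OF set_markov_joint[OF A]]) (use A in \<open>simp add: channel_into_def\<close>)
  have "info_XT b unif V W = (\<Sum>t\<in>A. \<Sum>x\<in>UNIV.
      mass W t * (1 / real n) * post W t x * log b (mass W t * (1 / real n) * post W t x / (1 / real n * mass W t)))"
    unfolding info_XT_def
  proof (subst mutual_info_sum[OF b1 fin, of UNIV _ A])
    show "finite A" using A by (simp add: channel_into_def)
    show "(\<lambda>(y, x, t). t) ` set_pmf (markov_joint unif V W) \<subseteq> A"
      using set_markov_joint[OF A] by auto
  qed (simp_all only: finite subset_UNIV markov_joint_X markov_joint_T markov_joint_XT pmf_X pmf_T mass_XT)
  also have "\<dots> = (\<Sum>t\<in>A. \<Sum>x\<in>UNIV. mass W t * (xlnx (post W t x) / real n) / ln b)"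
    unfolding entropy_term ..
  finally show ?thesis
    by (simp add: D_def sum_distrib_left sum_divide_distrib)
qed

lemma info_YT_eq:
  assumes A: "channel_into A W"
  shows "info_YT b unif V W = (\<Sum>t\<in>A. mass W t * E (post W t)) / ln b"
proof -
  have fin: "finite (set_pmf (markov_joint unif V W))"
    by (rule finite_subset[OF set_markov_joint[OF A]]) (use A in \<open>simp add: channel_into_def\<close>)
  have "info_YT b unif V W = (\<Sum>t\<in>A. \<Sum>y\<in>UNIV.
      mass W t * (1 / real n) * (1 + s * (post W t y - 1)) *
      log b (mass W t * (1 / real n) * (1 + s * (post W t y - 1)) / (1 / real n * mass W t)))"
    unfolding info_YT_def
  proof (subst mutual_info_sum[OF b1 fin, of UNIV _ A])
    show "finite A" using A by (simp add: channel_into_def)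
    show "(\<lambda>(y, x, t). t) ` set_pmf (markov_joint unif V W) \<subseteq> A"
      using set_markov_joint[OF A] by auto
  qed (simp_all only: finite subset_UNIV markov_joint_Y markov_joint_T markov_joint_YT pmf_T mass_V mass_YT)
  also have "\<dots> = (\<Sum>t\<in>A. \<Sum>y\<in>UNIV. mass W t * (xlnx (1 + s * (post W t y - 1)) / real n) / ln b)"
    unfolding entropy_term ..
  finally show ?thesis
    by (simp add: E_def sum_distrib_left sum_divide_distrib)
qed

lemma entropy_D:
  "log b (real n) - pmf_entropy b p = D (\<lambda>x. real n * pmf p x) / ln b"
proof -
  have "xlnx (real n * pmf p x) / real n = pmf p x * ln (real n) + pmf p x * ln (pmf p x)" for x
    using n_pos pmf_nonneg[of p x]
    by (cases "pmf p x = 0") (simp_all add: xlnx_def ln_mult distrib_left add_divide_distrib)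
  then have "D (\<lambda>x. real n * pmf p x) = ln (real n) * (\<Sum>x\<in>UNIV. pmf p x) + (\<Sum>x\<in>UNIV. pmf p x * ln (pmf p x))"
    by (simp add: D_def sum_divide_distrib sum.distrib sum_distrib_left mult.commute)
  also have "(\<Sum>x\<in>UNIV. pmf p x) = 1" by (rule sum_pmf_eq_1) auto
  finally show ?thesis
    by (simp add: pmf_entropy_finite[OF b1] log_def add_divide_distrib sum_divide_distrib)
qed

lemma entropy_E:
  "log b (real n) - pmf_entropy b (bind_pmf p V) = E (\<lambda>x. real n * pmf p x) / ln b"
proof -
  have "real n * pmf (bind_pmf p V) y = 1 + s * (real n * pmf p y - 1)" for y
  proof -
    have "pmf (bind_pmf p V) y = (\<Sum>x\<in>UNIV. \<alpha> * pmf p x + (if x = y then s * pmf p y else 0))"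
      unfolding pmf_bind_finite by (intro sum.cong) (auto simp: pmf_V algebra_simps)
    also have "\<dots> = \<alpha> * (\<Sum>x\<in>UNIV. pmf p x) + s * pmf p y"
      by (simp add: sum.distrib sum_distrib_left)
    also have "(\<Sum>x\<in>UNIV. pmf p x) = 1" by (rule sum_pmf_eq_1) auto
    finally show ?thesis unfolding s_eq by algebra
  qed
  then show ?thesis unfolding entropy_D by (simp add: D_def E_def)
qed

lemma phi_eq:
  "phi b V R = Sup {E w / ln b | w. weights w \<and> D w / ln b \<le> R}"
proof -
  have "\<exists>p. w = (\<lambda>x. real n * pmf p x)" if w: "weights w" for w :: "'x \<Rightarrow> real"
  proof -
    obtain p where "\<And>x. pmf p x = w x / real n"
      by (rule finite_pmf_exists[of "\<lambda>x. w x / real n"])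
        (use w n_pos in \<open>auto simp: weights_def sum_divide_distrib[symmetric]\<close>)
    then show ?thesis using n_pos by (intro exI[of _ p]) auto
  qed
  moreover have "weights (\<lambda>x. real n * pmf p x)" for p :: "'x pmf"
    by (auto simp: weights_def sum_distrib_left[symmetric] sum_pmf_eq_1)
  ultimately have "{E (\<lambda>x. real n * pmf p x) / ln b |p. D (\<lambda>x. real n * pmf p x) / ln b \<le> R} =
      {E w / ln b | w. weights w \<and> D w / ln b \<le> R}"
    by blast
  then show ?thesis
    unfolding phi_def card entropy_E unfolding entropy_D by (rule arg_cong)
qed


section \<open>Lagrangian duality and the value of the bottleneck function\<close>

lemma weights_peaked:
  assumes "e \<in> {0..1}"
  shows "weights (peaked e (x0 :: 'x))"
proof -
  have "(\<Sum>x\<in>UNIV. peaked e x0 x) = real n"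
    using sum_peaked[OF card, of "\<lambda>z. z" e x0] by (simp add: n_eq algebra_simps)
  moreover have "0 \<le> 1 + k * e" using plain_dom[of e] assms by simp
  ultimately show ?thesis using assms by (auto simp: weights_def peaked_def)
qed

lemma weights_one: "weights (\<lambda>_ :: 'x. 1)"
  using weights_peaked[of 0 undefined] by (simp add: peaked_0)

lemma peaked_sym: "peaked e x0 x = peaked e x x0"
  by (simp add: peaked_def)

lemma lagrangian_bound:
  assumes l: "0 \<le> l" and M: "\<And>e. e \<in> {0..1} \<Longrightarrow> G l e \<le> M" and w: "weights w"
  shows "E w - l * D w \<le> M"
    and "E w - l * D w = M \<Longrightarrow> \<exists>e\<in>{0..1}. \<exists>x0. w = peaked e x0 \<and> G l e = M"
proof -
  have "(\<Sum>x\<in>UNIV. F l (w x)) \<le> real n * M"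
    by (rule simplex_bound(1)[OF card l M w])
  then show "E w - l * D w \<le> M" unfolding F_sum using n_pos by simp
  assume "E w - l * D w = M"
  then have "(\<Sum>x\<in>UNIV. F l (w x)) = real n * M" unfolding F_sum by simp
  then show "\<exists>e\<in>{0..1}. \<exists>x0. w = peaked e x0 \<and> G l e = M"
    by (intro simplex_bound(2)[OF card l _ w]) (use M in auto)
qed

text \<open>Weak duality with slackness: the difference of the two sides is the average over
  \<open>t\<close> of the nonnegative slacks \<open>M - (E - l * D)\<close>. In case of equality
  each slack of positive mass is 0.\<close>

lemma dual_bound:
  assumes M: "\<And>w. weights w \<Longrightarrow> E w - l * D w \<le> M" and A: "channel_into A W"
  shows "info_YT b unif V W * ln b \<le> l * (info_XT b unif V W * ln b) + M"
    and "info_YT b unif V W * ln b = l * (info_XT b unif V W * ln b) + M \<Longrightarrow>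
      t \<in> A \<Longrightarrow> 0 < mass W t \<Longrightarrow> E (post W t) - l * D (post W t) = M"
proof -
  let ?gap = "\<lambda>t. mass W t * (M - (E (post W t) - l * D (post W t)))"
  have nonneg: "0 \<le> ?gap t" for t
    using M[OF weights_post, of W t] mass_nonneg[of W t] by (cases "mass W t = 0") auto
  have "(\<Sum>t\<in>A. ?gap t) = M * (\<Sum>t\<in>A. mass W t) - (\<Sum>t\<in>A. mass W t * E (post W t)) +
      l * (\<Sum>t\<in>A. mass W t * D (post W t))"
    by (simp add: sum_subtractf sum.distrib sum_distrib_left algebra_simps)
  then have gap: "(\<Sum>t\<in>A. ?gap t) =
      l * (info_XT b unif V W * ln b) + M - info_YT b unif V W * ln b"
    using lnb_pos sum_mass[OF A] by (simp add: info_XT_eq[OF A] info_YT_eq[OF A])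
  have "0 \<le> (\<Sum>t\<in>A. ?gap t)" by (intro sum_nonneg nonneg)
  then show "info_YT b unif V W * ln b \<le> l * (info_XT b unif V W * ln b) + M"
    using gap by linarith
  assume eq: "info_YT b unif V W * ln b = l * (info_XT b unif V W * ln b) + M"
    and t: "t \<in> A" "0 < mass W t"
  have "(\<Sum>t\<in>A. ?gap t) = 0" using gap eq by linarith
  moreover have "finite A" using A by (simp add: channel_into_def)
  ultimately have "?gap t = 0" using t(1) nonneg by (simp add: sum_nonneg_eq_0_iff)
  then show "E (post W t) - l * D (post W t) = M" using t(2) by simp
qed

text \<open>Time sharing of a constant letter and a Hamming channel. Letters of mass 0 are dropped
  when \<open>\<theta>\<close> is 0 or 1, which accounts for the three cardinalities.\<close>

lemma achievable:
  assumes \<theta>: "\<theta> \<in> {0..1}" and e: "e \<in> {0..1}"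
  obtains A :: "nat set" and W where "channel_into A W"
    "card A = (if \<theta> = 0 then 1 else if \<theta> = 1 then n else n + 1)"
    "info_XT b unif V W * ln b = \<theta> * X e" "info_YT b unif V W * ln b = \<theta> * X (s * e)"
proof -
  \<comment> \<open>\<open>None\<close> is the constant letter and \<open>Some x'\<close> the letter
    with peak at \<open>x'\<close>. Symmetry of \<open>peaked\<close> makes the rows sum to 1 as
    well as the columns.\<close>
  define f where "f x = (\<lambda>z. case z of None \<Rightarrow> 1 - \<theta> | Some x' \<Rightarrow> \<theta> * (peaked e x' x / real n))"
    for x :: 'x
  have sum_opt: "(\<Sum>z\<in>UNIV. h z) = h None + (\<Sum>x'\<in>UNIV. h (Some x'))" for h :: "'x option \<Rightarrow> real"
    by (simp add: UNIV_option_conv sum.reindex)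
  have sum_peak: "(\<Sum>x'\<in>UNIV. peaked e x' x) = real n" for x :: 'x
    using weights_peaked[OF e, of x] by (simp add: weights_def peaked_sym[of e _ x])
  have peak_nonneg: "0 \<le> peaked e x' x" for x x' :: 'x
    using weights_peaked[OF e, of x'] by (simp add: weights_def)
  have "\<exists>p. \<forall>z. pmf p z = f x z" for x
  proof -
    have "0 \<le> f x z" for z
      using \<theta> peak_nonneg by (auto simp: f_def split: option.split)
    moreover have "(\<Sum>z\<in>UNIV. f x z) = 1"
      using sum_peak[of x] n_pos
      by (simp add: sum_opt f_def sum_distrib_left[symmetric] sum_divide_distrib[symmetric])
    ultimately show ?thesis using finite_pmf_exists[of "f x"] by metis
  qed
  then obtain P where P: "\<And>x z. pmf (P x) z = f x z" by metis
  \<comment> \<open>The alphabet is moved into the naturals, over which \<open>IB\<close> takes its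
    supremum.\<close>
  obtain g :: "'x option \<Rightarrow> nat" where g: "inj g"
    using finite_imp_inj_to_nat_seg[of "UNIV :: 'x option set"] by auto
  define W where "W x = map_pmf g (P x)" for x
  define B :: "'x option set" where
    "B = (if \<theta> = 0 then {None} else if \<theta> = 1 then range Some else UNIV)"
  have W: "pmf (W x) (g z) = f x z" for x z
    unfolding W_def using pmf_map_inj'[OF g] P by metis
  have outside: "f x z = 0" if "z \<notin> B" for x z
    using that by (auto simp: B_def f_def split: option.splits if_splits)
  have chan: "channel_into (g ` B) W"
    unfolding channel_into_def
  proof (intro conjI allI)
    show "set_pmf (W x) \<subseteq> g ` B" for x
      using outside P unfolding W_def by (auto simp: set_pmf_iff) (metis image_eqI)
  qed simp
  have mass_None: "mass W (g None) = 1 - \<theta>"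
    using n_pos by (simp add: mass_def W f_def card)
  have mass_Some: "mass W (g (Some x)) = \<theta> / real n" for x
    using n_pos weights_peaked[OF e, of x]
    by (simp add: mass_def W f_def weights_def sum_distrib_left[symmetric] sum_divide_distrib[symmetric])
  have post_None: "post W (g None) = (\<lambda>_. 1)" if "\<theta> \<noteq> 1"
    using that by (auto simp: post_def mass_None W f_def)
  have post_Some: "post W (g (Some x)) = peaked e x" if "\<theta> \<noteq> 0" for x
    using that n_pos by (auto simp: post_def mass_Some W f_def)
  have sumB: "(\<Sum>t\<in>g ` B. mass W t * h (post W t)) = \<theta> * c"
    if h: "h (\<lambda>_. 1) = 0" "\<And>x. h (peaked e x) = c" for h c
  proof -
    have zero: "mass W (g z) = 0" if "z \<notin> B" for z
      using outside[OF that] by (simp add: mass_def W)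
    have "(\<Sum>t\<in>g ` B. mass W t * h (post W t)) = (\<Sum>z\<in>B. mass W (g z) * h (post W (g z)))"
      using g by (subst sum.reindex) (auto intro: inj_on_subset)
    also have "\<dots> = (\<Sum>z\<in>UNIV. mass W (g z) * h (post W (g z)))"
      by (rule sum.mono_neutral_left) (auto simp: zero)
    also have "\<dots> = \<theta> * c"
      unfolding sum_opt mass_None mass_Some
      using h n_pos card post_None post_Some by (cases "\<theta> = 1"; cases "\<theta> = 0") auto
    finally show ?thesis .
  qed
  have "card (g ` B) = card B" using g by (intro card_image) (auto intro: inj_on_subset)
  also have "\<dots> = (if \<theta> = 0 then 1 else if \<theta> = 1 then n else n + 1)"
    by (simp add: B_def card_image card_UNIV_option card)
  finally show ?thesis
    using that[OF chan] lnb_pos sumB[of D "X e"] sumB[of E "X (s * e)"]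
    by (simp add: info_XT_eq[OF chan] info_YT_eq[OF chan] D_peaked E_peaked)
qed

text \<open>Weak duality bounds every admissible channel by the line with slope \<open>l\<close> and
  intercept \<open>M\<close>, and the time-sharing channel lies on that line at rate
  \<open>R\<close>.\<close>

lemma IB_eq:
  assumes l: "0 \<le> l" and M: "\<And>w. weights w \<Longrightarrow> E w - l * D w \<le> M"
    and \<theta>: "\<theta> \<in> {0..1}" and e: "e \<in> {0..1}"
    and R: "R * ln b = \<theta> * X e" and tight: "\<theta> * X (s * e) = l * (\<theta> * X e) + M"
  shows "IB b R unif V * ln b = l * (R * ln b) + M"
proof -
  obtain A :: "nat set" and W where W: "channel_into A W"
    "info_XT b unif V W * ln b = \<theta> * X e" "info_YT b unif V W * ln b = \<theta> * X (s * e)"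
    using achievable[OF \<theta> e] by metis
  have "IB b R unif V = info_YT b unif V W"
    unfolding IB_def
  proof (rule cSup_eq_maximum)
    have "info_XT b unif V W * ln b = R * ln b" using W R by simp
    then have "info_XT b unif V W = R" using lnb_pos by simp
    then show "info_YT b unif V W \<in>
       {info_YT b unif V W |(A :: nat set) W. channel_into A W \<and> info_XT b unif V W \<le> R}"
      using W(1) by blast
  next
    fix y assume "y \<in> {info_YT b unif V W |(A :: nat set) W. channel_into A W \<and> info_XT b unif V W \<le> R}"
    then obtain A' :: "nat set" and W' where W': "channel_into A' W'" "info_XT b unif V W' \<le> R"
      "y = info_YT b unif V W'" by blast
    have "l * (info_XT b unif V W' * ln b) \<le> l * (R * ln b)"
      using W'(2) lnb_pos l by (intro mult_left_mono mult_right_mono) auto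
    then have "info_YT b unif V W' * ln b \<le> info_YT b unif V W * ln b"
      using dual_bound(1)[OF M W'(1)] tight R W(3) by simp
    then show "y \<le> info_YT b unif V W" using lnb_pos W'(3) by simp
  qed
  then show ?thesis using W(3) tight R by simp
qed

text \<open>A maximizer turns weak duality into an equality, so all its posteriors of positive mass
  are tight; for \<open>0 < l\<close> its rate is exactly \<open>R\<close>. Comparison with the
  time-sharing maximizer bounds the cardinality.\<close>

lemma minimal_maximizer_tight:
  fixes A :: "'t set"
  assumes l: "0 \<le> l" and M: "\<forall>w. weights w \<longrightarrow> E w - l * D w \<le> M"
    and \<theta>: "\<theta> \<in> {0..1}" and e: "e \<in> {0..1}"
    and R: "R * ln b = \<theta> * X e" and tight: "\<theta> * X (s * e) = l * (\<theta> * X e) + M"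
    and min: "minimal_IB_maximizer b R unif V A W"
  shows "channel_into A W"
    and "card A \<le> (if \<theta> = 0 then 1 else if \<theta> = 1 then n else n + 1)"
    and "\<And>t. t \<in> A \<Longrightarrow> 0 < mass W t \<Longrightarrow> E (post W t) - l * D (post W t) = M"
    and "0 < l \<Longrightarrow> (\<Sum>t\<in>A. mass W t * D (post W t)) = R * ln b"
proof -
  have W: "channel_into A W" "info_XT b unif V W \<le> R" "info_YT b unif V W = IB b R unif V"
    and less: "\<And>(A' :: nat set) W'. IB_maximizer b R unif V A' W' \<Longrightarrow> card A \<le> card A'"
    using min unfolding minimal_IB_maximizer_def IB_maximizer_def by (auto simp: not_less)
  note M = M[rule_format]
  note IB = IB_eq[OF l M \<theta> e R tight]
  show chan: "channel_into A W" by fact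
  have "l * (info_XT b unif V W * ln b) \<le> l * (R * ln b)"
    using W(2) lnb_pos l by (intro mult_left_mono mult_right_mono) auto
  moreover have "info_YT b unif V W * ln b = l * (R * ln b) + M" using IB W(3) by simp
  moreover note dual_bound(1)[OF M chan]
  ultimately have eqs: "info_YT b unif V W * ln b = l * (info_XT b unif V W * ln b) + M"
    "l * (info_XT b unif V W * ln b) = l * (R * ln b)" by linarith+
  show "\<And>t. t \<in> A \<Longrightarrow> 0 < mass W t \<Longrightarrow> E (post W t) - l * D (post W t) = M"
    by (rule dual_bound(2)[OF M chan eqs(1)])
  show "(\<Sum>t\<in>A. mass W t * D (post W t)) = R * ln b" if "0 < l"
    using eqs(2) that lnb_pos by (simp add: info_XT_eq[OF chan])
  obtain A' :: "nat set" and W' where W': "channel_into A' W'"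
    "card A' = (if \<theta> = 0 then 1 else if \<theta> = 1 then n else n + 1)"
    "info_XT b unif V W' * ln b = \<theta> * X e" "info_YT b unif V W' * ln b = \<theta> * X (s * e)"
    using achievable[OF \<theta> e] by metis
  have "info_XT b unif V W' * ln b = R * ln b" "info_YT b unif V W' * ln b = IB b R unif V * ln b"
    using W' R tight IB by simp_all
  then have "IB_maximizer b R unif V A' W'"
    using W'(1) lnb_pos by (simp add: IB_maximizer_def)
  then show "card A \<le> (if \<theta> = 0 then 1 else if \<theta> = 1 then n else n + 1)"
    using less[of A' W'] W'(2) by simp
qed

text \<open>The posteriors average to the uniform distribution, so every input letter is the peak of some
  representation letter.\<close>

lemma peaked_posteriors:
  fixes A B :: "'t set"
  assumes chan: "channel_into A W" and B: "B \<subseteq> A" and e: "e \<in> {0<..1}"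
    and peak: "\<And>t. t \<in> B \<Longrightarrow> \<exists>x0. post W t = peaked e x0"
    and flat: "\<And>t. t \<in> A - B \<Longrightarrow> mass W t = 0 \<or> post W t = (\<lambda>_. 1)"
    and mass_B: "(\<Sum>t\<in>B. mass W t) = \<theta>" and \<theta>: "0 < \<theta>"
  shows "n \<le> card B"
    and "card B \<le> n \<Longrightarrow> \<exists>\<tau>. bij_betw \<tau> UNIV B \<and>
      (\<forall>x x'. pmf (W x) (\<tau> x') = \<theta> * (peaked e x' x / real n))"
proof -
  have fin: "finite A" "finite B" using chan B finite_subset by (auto simp: channel_into_def)
  obtain c where c: "\<And>t. t \<in> B \<Longrightarrow> post W t = peaked e (c t)" using peak by metis
  \<comment> \<open>Both the transition probabilities from \<open>x\<close> and the masses sum to 1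
    over \<open>A\<close>. Comparing the sums shows that the letters with peak at \<open>x\<close>
    carry total mass \<open>\<theta> / real n\<close>.\<close>
  have avg: "e * \<theta> = real n * e * (\<Sum>t\<in>{t\<in>B. c t = x}. mass W t)" for x
  proof -
    have "(\<Sum>t\<in>A - B. pmf (W x) t) = (\<Sum>t\<in>A - B. mass W t)"
      using flat by (intro sum.cong refl) (metis pmf_posterior mult.right_neutral mult_zero_left)
    moreover have "(\<Sum>t\<in>B. pmf (W x) t) =
        (\<Sum>t\<in>B. (1 - e) * mass W t + (if c t = x then real n * e * mass W t else 0))"
      using c by (intro sum.cong) (auto simp: pmf_posterior peaked_def n_eq algebra_simps)
    moreover have "(\<Sum>t\<in>B. if c t = x then real n * e * mass W t else 0) =
        real n * e * (\<Sum>t\<in>{t\<in>B. c t = x}. mass W t)"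
      using fin by (simp add: sum_distrib_left flip: sum.inter_filter)
    moreover have "(\<Sum>t\<in>A. pmf (W x) t) = (\<Sum>t\<in>A - B. pmf (W x) t) + (\<Sum>t\<in>B. pmf (W x) t)"
      "(\<Sum>t\<in>A. mass W t) = (\<Sum>t\<in>A - B. mass W t) + (\<Sum>t\<in>B. mass W t)"
      using sum.subset_diff[OF B fin(1)] by blast+
    ultimately have "1 - (\<Sum>t\<in>B. mass W t) + ((1 - e) * (\<Sum>t\<in>B. mass W t) +
        real n * e * (\<Sum>t\<in>{t\<in>B. c t = x}. mass W t)) = 1"
      using sum_pmf_channel[OF chan, of x] sum_mass[OF chan]
      by (simp add: sum.distrib sum_distrib_left)
    then show ?thesis unfolding mass_B by algebra
  qed
  have surj: "c ` B = UNIV"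
  proof (rule ccontr)
    assume "c ` B \<noteq> UNIV"
    then obtain x where "x \<notin> c ` B" by blast
    then have none: "{t\<in>B. c t = x} = {}" by blast
    have "e * \<theta> = 0" using avg[of x] unfolding none by simp
    then show False using e \<theta> by auto
  qed
  then have "n = card (c ` B)" using card by simp
  also have "\<dots> \<le> card B" by (rule card_image_le[OF fin(2)])
  finally show n_le: "n \<le> card B" .
  assume "card B \<le> n"
  then have "card (c ` B) = card B" using n_le surj card by simp
  then have inj: "inj_on c B" using fin(2) by (simp add: eq_card_imp_inj_on)
  then have bij: "bij_betw c B UNIV" using surj by (simp add: bij_betw_def)
  define \<tau> where "\<tau> = inv_into B c"
  have \<tau>: "bij_betw \<tau> UNIV B" unfolding \<tau>_def by (rule bij_betw_inv_into[OF bij])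
  have \<tau>B: "\<tau> x \<in> B" "c (\<tau> x) = x" for x
    using surj by (auto simp: \<tau>_def inv_into_into f_inv_into_f)
  have "pmf (W x) (\<tau> x') = \<theta> * (peaked e x' x / real n)" for x x'
  proof -
    have "\<tau> (c t) = t" if "t \<in> B" for t
      unfolding \<tau>_def by (rule inv_into_f_f[OF inj that])
    then have "{t\<in>B. c t = x'} = {\<tau> x'}" using \<tau>B by force
    then have "e * \<theta> = real n * e * mass W (\<tau> x')" using avg[of x'] by simp
    then have "mass W (\<tau> x') = \<theta> / real n" using e n_pos by (simp add: field_simps)
    then show ?thesis using pmf_posterior[of W x "\<tau> x'"] c[OF \<tau>B(1)] \<tau>B(2) by simp
  qed
  then show "\<exists>\<tau>. bij_betw \<tau> UNIV B \<and>
      (\<forall>x x'. pmf (W x) (\<tau> x') = \<theta> * (peaked e x' x / real n))" using \<tau> by blast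
qed

text \<open>The substitution \<open>q = (1 - e) / n\<close> turns \<open>h_fun\<close> into log n
  minus the divergence \<open>X e\<close> in base \<open>b\<close>. Injectivity on
  \<open>[0, 1/n]\<close> then follows from strict monotonicity of \<open>X\<close>.\<close>

lemma h_inv_X:
  assumes e: "e \<in> {0..1}"
  shows "h_inv b n (log b (real n) - X e / ln b) = (1 - e) / real n"
proof -
  have h: "h_fun b n ((1 - e) / real n) = log b (real n) - X e / ln b" if e: "e \<in> {0..1}" for e
  proof -
    have a: "1 - k * ((1 - e) / real n) = (1 + k * e) / real n"
      using n_pos by (simp add: k_def field_simps)
    have d: "(z / real n) * ln (z / real n) = (xlnx z - z * ln (real n)) / real n" if "0 \<le> z" for z
      using that n_pos by (cases "z = 0") (auto simp: xlnx_def ln_div right_diff_distrib diff_divide_distrib)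
    have scale: "(- p * (u / c) - k * q * (v / c)) * c = - (p * u) - k * (q * v)"
      if "c \<noteq> 0" for p q u v c :: real
      using that by (simp add: field_simps)
    have "h_fun b n ((1 - e) / real n) * ln b =
        - ((1 + k * e) / real n * ln ((1 + k * e) / real n)) - k * ((1 - e) / real n * ln ((1 - e) / real n))"
      unfolding h_fun_def log_def k_def[symmetric] a using lnb_pos by (intro scale) auto
    also have "\<dots> = - ((xlnx (1 + k * e) - (1 + k * e) * ln (real n)) / real n)
        - k * ((xlnx (1 - e) - (1 - e) * ln (real n)) / real n)"
      using e plain_dom[of e] by (subst (1 2) d) auto
    also have "\<dots> = ((1 + k * e) + k * (1 - e)) * ln (real n) / real n - X e"
      unfolding X_def using n_pos by (simp add: field_simps)
    also have "(1 + k * e) + k * (1 - e) = real n" by (simp add: n_eq algebra_simps)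
    finally show ?thesis using lnb_pos n_pos by (simp add: log_def field_simps)
  qed
  have "inj_on (h_fun b n) {0..1 / real n}"
  proof (rule inj_onI)
    fix q q' assume q: "q \<in> {0..1 / real n}" "q' \<in> {0..1 / real n}" "h_fun b n q = h_fun b n q'"
    define a where "a = 1 - real n * q"
    define a' where "a' = 1 - real n * q'"
    have a: "a \<in> {0..1}" "a' \<in> {0..1}" "q = (1 - a) / real n" "q' = (1 - a') / real n"
      using q n_pos by (auto simp: a_def a'_def field_simps)
    have "X a = X a'" using q(3) lnb_pos h[OF a(1)] h[OF a(2)] a(3,4) by simp
    then have "a = a'" using a X_strict_mono[of a a'] X_strict_mono[of a' a]
      by (cases a a' rule: linorder_cases) auto
    then show "q = q'" using a by simp
  qed
  moreover have "(1 - e) / real n \<in> {0..1 / real n}" using e n_pos by (simp add: divide_right_mono)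
  ultimately show ?thesis
    unfolding h_inv_def using the_inv_into_f_f h[OF e] by metis
qed

section \<open>The function \<phi> and the critical rate\<close>

text \<open>Continuity of \<open>D\<close> makes the constraint set closed in the compact simplex,
  and it contains the uniform distribution, whose divergence is 0.\<close>

lemma attained_under_constraint:
  assumes "0 \<le> R"
  obtains w where "weights w" "D w \<le> R" "\<And>v. weights v \<Longrightarrow> D v \<le> R \<Longrightarrow> E v \<le> E w"
proof -
  define S where "S = {w :: real ^ 'x. weights (($) w)}"
  define S' where "S' = {w \<in> S. D (($) w) \<le> R}"
  have le: "0 \<le> w $ x" "w $ x \<le> real n" if "w \<in> S" for w x
    using that weights_le[of "($) w" x] by (auto simp: S_def weights_def)
  have compact: "compact S" unfolding S_def by (rule compact_weights)
  have coord: "continuous_on S (\<lambda>w. w $ x)" for x by (intro continuous_intros)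
  have D: "continuous_on S (\<lambda>w. D (($) w))"
    unfolding D_def
    by (intro continuous_on_divide continuous_on_sum continuous_on_xlnx_compose coord
        continuous_on_const) (use le n_pos in auto)
  have E: "continuous_on S (\<lambda>w. E (($) w))"
    unfolding E_def
  proof (intro continuous_on_divide continuous_on_sum continuous_on_const)
    fix x
    have "continuous_on S (\<lambda>w. 1 + s * (w $ x - 1))" by (intro continuous_intros)
    then show "continuous_on S (\<lambda>w. xlnx (1 + s * (w $ x - 1)))"
      by (rule continuous_on_xlnx_compose) (use le output_dom in \<open>auto intro: less_imp_le\<close>)
  qed (use n_pos in auto)
  have "closedin (top_of_set S) S'"
    unfolding S'_def using continuous_closedin_preimage[OF D closed_atMost[of R]]
    by (simp add: vimage_def Int_def)
  then have "compact S'" using compact closedin_compact by blast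
  moreover have "(\<chi> x. 1) \<in> S'"
    using assms weights_one D_one by (simp add: S'_def S_def vec_lambda_inverse)
  then have "S' \<noteq> {}" by blast
  moreover have "continuous_on S' (\<lambda>w. E (($) w))"
    by (rule continuous_on_subset[OF E]) (simp add: S'_def)
  ultimately obtain w where w: "w \<in> S'" "\<And>v. v \<in> S' \<Longrightarrow> E (($) v) \<le> E (($) w)"
    using continuous_attains_sup by metis
  have "E v \<le> E (($) w)" if "weights v" "D v \<le> R" for v
    using w(2)[of "vec_lambda v"] that by (simp add: S'_def S_def vec_lambda_inverse)
  then show ?thesis using that[of "($) w"] w(1) by (simp add: S'_def S_def)
qed

lemma phi_attained:
  assumes "0 \<le> R"
  obtains w where "weights w" "D w / ln b \<le> R" "phi b V R = E w / ln b"
    "\<And>v. weights v \<Longrightarrow> D v / ln b \<le> R \<Longrightarrow> E v \<le> E w"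
proof -
  obtain w where w: "weights w" "D w \<le> R * ln b" "\<And>v. weights v \<Longrightarrow> D v \<le> R * ln b \<Longrightarrow> E v \<le> E w"
    using attained_under_constraint[of "R * ln b"] assms lnb_pos by auto
  have "phi b V R = E w / ln b"
    unfolding phi_eq
    by (rule cSup_eq_maximum) (use w lnb_pos in \<open>auto simp: field_simps intro!: exI[of _ w]\<close>)
  then show ?thesis using that w lnb_pos by (simp add: field_simps)
qed


text \<open>On the interval from 0 to \<open>Rc\<close> the concave envelope of \<phi> is the line
  of slope \<open>lc\<close> through the origin, and \<phi> meets this line at \<open>Rc\<close> but
  nowhere strictly between the ends.\<close>

lemma critical_rate_tangent:
  assumes ec: "0 < ec" "ec < 1" and lc: "0 < lc" and Gc: "G lc ec = 0"
    and bound: "\<And>w. weights w \<Longrightarrow> E w - lc * D w \<le> 0"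
    and tight: "\<And>w. weights w \<Longrightarrow> E w - lc * D w = 0 \<Longrightarrow> w = (\<lambda>_. 1) \<or> (\<exists>x0. w = peaked ec x0)"
  shows "critical_rate b V = X ec / ln b"
proof -
  define N where "N = log b (real n)"
  define \<phi> where "\<phi> = phi b V"
  define Rc where "Rc = X ec / ln b"
  have Rc0: "0 < Rc" using X_pos[of ec] ec lnb_pos by (simp add: Rc_def)
  have RcN: "Rc < N"
    using X_strict_mono[of ec 1] ec lnb_pos X_1 by (simp add: Rc_def N_def log_def divide_strict_right_mono)
  have \<phi>_le: "\<phi> R \<le> lc * R" if R: "0 \<le> R" for R
  proof -
    obtain w where w: "weights w" "D w / ln b \<le> R" "\<phi> R = E w / ln b"
      using phi_attained[OF R] \<phi>_def by metis
    have "E w / ln b \<le> lc * D w / ln b"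
      using bound[OF w(1)] lnb_pos by (intro divide_right_mono) auto
    also have "\<dots> \<le> lc * R" using mult_left_mono[OF w(2), of lc] lc by simp
    finally show ?thesis using w(3) by simp
  qed
  \<comment> \<open>Contact with the line would need a tight distribution of divergence exactly
    \<open>R\<close>, but tight ones have divergence 0 or \<open>Rc\<close>.\<close>
  have \<phi>_less: "\<phi> R < lc * R" if R: "0 < R" "R < Rc" for R
  proof (rule ccontr)
    assume "\<not> \<phi> R < lc * R"
    then have eq: "\<phi> R = lc * R" using \<phi>_le[of R] R by simp
    obtain w where w: "weights w" "D w / ln b \<le> R" "\<phi> R = E w / ln b"
      using phi_attained[of R] R \<phi>_def by (metis less_imp_le)
    have "lc * (D w / ln b) \<le> lc * R" using w(2) lc by (intro mult_left_mono) auto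
    moreover have "E w / ln b \<le> lc * D w / ln b"
      using bound[OF w(1)] lnb_pos by (intro divide_right_mono) auto
    ultimately have "lc * (D w / ln b) = lc * R" "E w / ln b = lc * D w / ln b"
      using eq w(3) by auto
    then have Dw: "D w / ln b = R" and "E w = lc * D w"
      using lc lnb_pos by (simp_all only: mult_cancel_left divide_cancel_right) auto
    then have "w = (\<lambda>_. 1) \<or> (\<exists>x0. w = peaked ec x0)" using tight[OF w(1)] by simp
    then have "D w / ln b = 0 \<or> D w / ln b = Rc" by (auto simp: D_peaked Rc_def)
    then show False using Dw R by auto
  qed
  have \<phi>_ge: "E v / ln b \<le> \<phi> R" if v: "weights v" "D v / ln b \<le> R" "0 \<le> R" for v R
  proof -
    obtain w where w: "\<phi> R = E w / ln b" "\<And>v. weights v \<Longrightarrow> D v / ln b \<le> R \<Longrightarrow> E v \<le> E w"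
      using phi_attained[OF v(3)] \<phi>_def by metis
    then show ?thesis using v lnb_pos by (simp add: divide_right_mono)
  qed
  have \<phi>0: "0 \<le> \<phi> 0" using \<phi>_ge[of "\<lambda>_. 1" 0] weights_one by simp
  have "lc * Rc = X (s * ec) / ln b" using Gc by (simp add: G_def Rc_def)
  moreover have "X (s * ec) / ln b \<le> \<phi> Rc"
    using \<phi>_ge[OF weights_peaked[of ec undefined], of Rc] ec Rc0 by (simp add: D_peaked E_peaked Rc_def)
  ultimately have \<phi>Rc: "lc * Rc \<le> \<phi> Rc" by simp
  define Maj where "Maj = {g. concave_on {0..N} g \<and> (\<forall>y\<in>{0..N}. \<phi> y \<le> g y)}"
  have env_def: "concave_envelope {0..N} \<phi> R = Inf ((\<lambda>g. g R) ` Maj)" for R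
    unfolding concave_envelope_def Maj_def by (rule arg_cong[of _ _ Inf]) auto
  have line: "(\<lambda>R. lc * R) \<in> Maj"
  proof -
    have "concave_on {0..N} (\<lambda>R. lc * R)"
      by (simp add: concave_on_iff algebra_simps)
    then show ?thesis using \<phi>_le by (simp add: Maj_def)
  qed
  \<comment> \<open>A concave majorant lies above its chord from 0 to \<open>Rc\<close>, and at both
    ends it is at least \<phi>, which is on or above the line there.\<close>
  have above: "lc * R \<le> g R" if g: "g \<in> Maj" and R: "0 \<le> R" "R \<le> Rc" for g R
  proof -
    let ?u = "R / Rc"
    have u: "0 \<le> ?u" "?u \<le> 1" "?u * Rc = R" using R Rc0 by auto
    have "(1 - ?u) * g 0 + ?u * g Rc \<le> g ((1 - ?u) *\<^sub>R 0 + ?u *\<^sub>R Rc)"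
      by (rule concave_onD) (use g u Rc0 RcN in \<open>auto simp: Maj_def\<close>)
    moreover have "\<phi> 0 \<le> g 0" using g Rc0 RcN unfolding Maj_def by auto
    then have "0 \<le> g 0" using \<phi>0 by linarith
    then have "0 \<le> (1 - ?u) * g 0" using u by simp
    moreover have "\<phi> Rc \<le> g Rc" using g Rc0 RcN by (simp add: Maj_def)
    then have "?u * (lc * Rc) \<le> ?u * g Rc" using \<phi>Rc u by (intro mult_left_mono) auto
    ultimately show ?thesis using u(3) by (simp add: mult.left_commute)
  qed
  have env: "concave_envelope {0..N} \<phi> R = lc * R" if R: "0 \<le> R" "R \<le> Rc" for R
    unfolding env_def
  proof (rule cInf_eq_minimum)
    show "lc * R \<in> (\<lambda>g. g R) ` Maj" using line by (rule rev_image_eqI) simp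
  qed (use above R in auto)
  have "critical_rate b V = Rc"
    unfolding critical_rate_def card N_def[symmetric] \<phi>_def[symmetric]
  proof (rule Least_equality)
    show "0 < Rc \<and> Rc \<le> N \<and> \<phi> Rc = concave_envelope {0..N} \<phi> Rc"
      using Rc0 RcN env[of Rc] \<phi>Rc \<phi>_le[of Rc] by simp
  next
    fix R assume R: "0 < R \<and> R \<le> N \<and> \<phi> R = concave_envelope {0..N} \<phi> R"
    show "Rc \<le> R"
    proof (rule ccontr)
      assume "\<not> Rc \<le> R"
      then show False using \<phi>_less[of R] env[of R] R by simp
    qed
  qed
  then show ?thesis by (simp add: Rc_def)
qed

section \<open>Minimal maximizers in the three ranges of the rate\<close>

lemma X_surj:
  assumes "0 \<le> R" "R \<le> log b (real n)"
  obtains e where "e \<in> {0..1}" "R * ln b = X e"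
proof -
  have "R * ln b \<le> log b (real n) * ln b" using assms lnb_pos by (intro mult_right_mono) auto
  then have "X 0 \<le> R * ln b" "R * ln b \<le> X 1"
    using assms lnb_pos X_1 by (simp_all add: log_def)
  then obtain e where "0 \<le> e" "e \<le> 1" "X e = R * ln b"
    using IVT'[of X 0 "R * ln b" 1] X_continuous by auto
  then show ?thesis using that by auto
qed

lemma peaked_channel_eq:
  "peaked e x' x / real n =
    (if x' = x then 1 - (real n - 1) * ((1 - e) / real n) else (1 - e) / real n)"
  using n_pos by (auto simp: peaked_def k_def field_simps)

text \<open>The case without a constant letter: the letters of positive mass carry mass 1 and need
  at least \<open>n\<close> members, so with at most \<open>n\<close> letters in \<open>A\<close>
  they exhaust it.\<close>

lemma all_peaked:
  fixes A :: "'t set"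
  assumes chan: "channel_into A W" and "card A \<le> n" and e: "e \<in> {0<..1}"
    and peak: "\<And>t. t \<in> A \<Longrightarrow> 0 < mass W t \<Longrightarrow> \<exists>x0. post W t = peaked e x0"
  shows "card A = n \<and> (\<exists>\<tau>. bij_betw \<tau> UNIV A \<and>
      (\<forall>x x'. pmf (W x) (\<tau> x') = peaked e x' x / real n))"
proof -
  define B where "B = {t \<in> A. 0 < mass W t}"
  have finA: "finite A" using chan by (simp add: channel_into_def)
  have BA: "B \<subseteq> A" by (auto simp: B_def)
  have flat: "mass W t = 0 \<or> post W t = (\<lambda>_. 1)" if "t \<in> A - B" for t
    using that mass_nonneg[of W t] by (auto simp: B_def)
  have "(\<Sum>t\<in>B. mass W t) = (\<Sum>t\<in>A. mass W t)"
    by (rule sum.mono_neutral_left[OF finA BA])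
      (use mass_nonneg in \<open>force simp: B_def not_less intro: antisym\<close>)
  then have mass_B: "(\<Sum>t\<in>B. mass W t) = 1" using sum_mass[OF chan] by simp
  have peakB: "\<exists>x0. post W t = peaked e x0" if "t \<in> B" for t
    using peak that by (simp add: B_def)
  note peaked = peaked_posteriors[OF chan BA e peakB flat mass_B zero_less_one]
  have "n \<le> card B" using peaked(1) by blast
  moreover have "card B \<le> card A" by (rule card_mono[OF finA BA])
  ultimately have cards: "card A = n" "card B = n" using \<open>card A \<le> n\<close> by auto
  then have "B = A" using card_subset_eq[OF finA BA] by simp
  then show ?thesis using peaked(2) cards by simp
qed

text \<open>Time sharing with \<open>\<theta> = 0\<close> is the constant channel, so one letter
  suffices; none is impossible because the masses sum to 1.\<close>

lemma zero_rate_maximizer: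
  assumes lc: "0 < lc" and bound: "\<And>w. weights w \<Longrightarrow> E w - lc * D w \<le> 0"
    and min: "minimal_IB_maximizer b 0 unif V A W"
  shows "card A = 1"
proof -
  have t: "channel_into A W" "card A \<le> 1"
    using minimal_maximizer_tight(1,2)[OF less_imp_le[OF lc] _ _ _ _ _ min, of 0 0 0] bound by auto
  have "A \<noteq> {}" using sum_mass[OF t(1)] by auto
  then show ?thesis using t by (simp add: channel_into_def card_gt_0_iff le_antisym Suc_le_eq)
qed

text \<open>Tight posteriors are uniform or peaked with parameter \<open>ec\<close>. Since the
  uniform ones have divergence 0, the rate fixes the mass of the peaked ones as
  \<open>\<theta>\<close>.\<close>

lemma subcritical_maximizer:
  fixes A :: "'t set"
  assumes ec: "0 < ec" "ec < 1" and lc: "0 < lc" and Gc: "G lc ec = 0"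
    and bound: "\<And>w. weights w \<Longrightarrow> E w - lc * D w \<le> 0"
    and tight: "\<And>w. weights w \<Longrightarrow> E w - lc * D w = 0 \<Longrightarrow> w = (\<lambda>_. 1) \<or> (\<exists>x0. w = peaked ec x0)"
    and R: "0 < R" "R < X ec / ln b"
    and min: "minimal_IB_maximizer b R unif V A W"
  defines "\<theta> \<equiv> R / (X ec / ln b)"
  shows "card A = n + 1 \<and> (\<exists>t0\<in>A. \<exists>\<tau>. bij_betw \<tau> UNIV (A - {t0}) \<and>
     (\<forall>x x'. pmf (W x) t0 = 1 - \<theta> \<and> pmf (W x) (\<tau> x') = \<theta> * (peaked ec x' x / real n)))"
proof -
  have Xec: "0 < X ec" using X_pos ec by simp
  have \<theta>: "0 < \<theta>" "\<theta> < 1" and R_eq: "R * ln b = \<theta> * X ec"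
    using R Xec lnb_pos by (auto simp: \<theta>_def field_simps)
  have *: "\<theta> * X (s * ec) = lc * (\<theta> * X ec) + 0" using Gc by (simp add: G_def)
  have bound': "\<forall>w. weights w \<longrightarrow> E w - lc * D w \<le> 0" using bound by blast
  have "\<theta> \<in> {0..1}" "ec \<in> {0..1}" using \<theta> ec by auto
  note mm = minimal_maximizer_tight[OF less_imp_le[OF lc] bound' this R_eq * min]
  have chan: "channel_into A W" by (rule mm(1))
  have cA: "card A \<le> n + 1" using mm(2) \<theta> by simp
  have finA: "finite A" using chan by (simp add: channel_into_def)
  \<comment> \<open>Letters of mass 0 fall outside \<open>B\<close> together with the uniform
    ones.\<close>
  define B where "B = {t \<in> A. 0 < mass W t \<and> post W t \<noteq> (\<lambda>_. 1)}"
  have BA: "B \<subseteq> A" by (auto simp: B_def)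
  have flat: "mass W t = 0 \<or> post W t = (\<lambda>_. 1)" if "t \<in> A - B" for t
    using that mass_nonneg[of W t] by (auto simp: B_def)
  have peakB: "\<exists>x0. post W t = peaked ec x0" if "t \<in> B" for t
    using that mm(3)[of t] tight[OF weights_post, of W t] by (auto simp: B_def)
  have "R * ln b = (\<Sum>t\<in>A. mass W t * D (post W t))" using mm(4)[OF lc] by simp
  also have "\<dots> = (\<Sum>t\<in>B. mass W t * D (post W t))"
    by (rule sum.mono_neutral_right[OF finA BA]) (use flat in fastforce)
  also have "\<dots> = (\<Sum>t\<in>B. mass W t * X ec)"
    using peakB by (intro sum.cong) (auto simp: D_peaked dest!: peakB)
  finally have "(\<Sum>t\<in>B. mass W t) * X ec = \<theta> * X ec" using R_eq by (simp add: sum_distrib_right)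
  then have mass_B: "(\<Sum>t\<in>B. mass W t) = \<theta>" using Xec by simp
  have "ec \<in> {0<..1}" using ec by simp
  note peaked = peaked_posteriors[OF chan BA this peakB flat mass_B \<theta>(1)]
  have nB: "n \<le> card B" using peaked(1) by blast
  have split: "(\<Sum>t\<in>A - B. mass W t) = 1 - \<theta>"
    using sum.subset_diff[OF BA finA, of "mass W"] sum_mass[OF chan] mass_B by simp
  have "A - B \<noteq> {}"
  proof
    assume "A - B = {}"
    then show False using split \<theta> unfolding \<open>A - B = {}\<close> by simp
  qed
  \<comment> \<open>At least one letter outside \<open>B\<close> and at least \<open>n\<close>
    inside meet the upper bound \<open>n + 1\<close>, so both counts are exact.\<close>
  then have "1 \<le> card (A - B)" using finA by (simp add: Suc_le_eq card_gt_0_iff)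
  moreover have "card (A - B) = card A - card B" "card B \<le> card A"
    using card_Diff_subset[OF finite_subset[OF BA finA] BA] card_mono[OF finA BA] by auto
  ultimately have cards: "card A = n + 1" "card B = n" "card (A - B) = 1"
    using nB cA by auto
  then obtain t0 where t0: "A - B = {t0}" by (meson card_1_singletonE)
  then have B_eq: "B = A - {t0}" and t0A: "t0 \<in> A" using BA by auto
  have mass0: "mass W t0 = 1 - \<theta>" using split t0 by simp
  then have "post W t0 = (\<lambda>_. 1)" using flat[of t0] t0 \<theta> by auto
  then have W0: "pmf (W x) t0 = 1 - \<theta>" for x using pmf_posterior[of W x t0] mass0 by simp
  obtain \<tau> where "bij_betw \<tau> UNIV B" "\<And>x x'. pmf (W x) (\<tau> x') = \<theta> * (peaked ec x' x / real n)"
    using peaked(2) cards by blast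
  then show ?thesis using W0 cards(1) t0A unfolding B_eq by blast
qed

text \<open>Beyond \<open>ec\<close> a multiplier exists for which \<open>e\<close> is the strict
  maximum, so tightness alone forces the peak parameter. At \<open>ec\<close> itself tightness also
  permits uniform posteriors, and the rate excludes them.\<close>

lemma supercritical_maximizer:
  fixes A :: "'t set"
  assumes ec: "0 < ec" "ec < 1" and lc: "0 < lc" and Gc: "G lc ec = 0"
    and G_le: "\<And>e. e \<in> {0..1} \<Longrightarrow> G lc e \<le> 0"
    and bound: "\<And>w. weights w \<Longrightarrow> E w - lc * D w \<le> 0"
    and tight: "\<And>w. weights w \<Longrightarrow> E w - lc * D w = 0 \<Longrightarrow> w = (\<lambda>_. 1) \<or> (\<exists>x0. w = peaked ec x0)"
    and e: "ec \<le> e" "e \<le> 1" and R: "R * ln b = X e"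
    and min: "minimal_IB_maximizer b R unif V A W"
  shows "card A = n \<and> (\<exists>\<tau>. bij_betw \<tau> UNIV A \<and>
      (\<forall>x x'. pmf (W x) (\<tau> x') = peaked e x' x / real n))"
proof (cases "e = ec")
  case True
  have *: "1 * X (s * ec) = lc * (1 * X ec) + 0" using Gc by (simp add: G_def)
  have R_eq: "R * ln b = 1 * X ec" using R True by simp
  have bound': "\<forall>w. weights w \<longrightarrow> E w - lc * D w \<le> 0" using bound by blast
  have "1 \<in> {0..1::real}" "ec \<in> {0..1}" using ec by auto
  note mm = minimal_maximizer_tight[OF less_imp_le[OF lc] bound' this R_eq * min]
  have chan: "channel_into A W" by (rule mm(1))
  have finA: "finite A" using chan by (simp add: channel_into_def)
  have cases: "post W t = (\<lambda>_. 1) \<or> (\<exists>x0. post W t = peaked ec x0)" if "t \<in> A" "0 < mass W t" for t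
    using that mm(3)[of t] tight[OF weights_post, of W t] by simp
  have Xec: "0 < X ec" using X_pos ec by simp
  have nonneg: "0 \<le> mass W t * (X ec - D (post W t))" if "t \<in> A" for t
  proof (cases "mass W t = 0")
    case False
    then have "0 < mass W t" using mass_nonneg[of W t] by simp
    moreover from this have "D (post W t) \<le> X ec" using cases[OF that] Xec by (auto simp: D_peaked)
    ultimately show ?thesis by simp
  qed simp
  \<comment> \<open>No tight posterior has divergence above \<open>X ec\<close>, yet the average
    equals it, so each term of this nonnegative sum vanishes.\<close>
  have "(\<Sum>t\<in>A. mass W t * (X ec - D (post W t))) =
      (\<Sum>t\<in>A. mass W t) * X ec - (\<Sum>t\<in>A. mass W t * D (post W t))"
    by (simp add: right_diff_distrib sum_subtractf sum_distrib_right)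
  also have "\<dots> = 0" using sum_mass[OF chan] mm(4)[OF lc] R_eq by simp
  finally have zero: "mass W t * (X ec - D (post W t)) = 0" if "t \<in> A" for t
    using that nonneg finA by (simp add: sum_nonneg_eq_0_iff)
  have peak: "\<exists>x0. post W t = peaked ec x0" if t: "t \<in> A" "0 < mass W t" for t
  proof -
    have "D (post W t) = X ec" using zero[OF t(1)] t(2) by simp
    then have "post W t \<noteq> (\<lambda>_. 1)" using Xec by auto
    then show ?thesis using cases[OF t] by simp
  qed
  show ?thesis
    unfolding True by (rule all_peaked[OF chan _ _ peak]) (use mm(2) ec in simp_all)
next
  case False
  then have ece: "ec < e" using e by simp
  have "\<exists>l\<ge>0. \<forall>e'\<in>{0..1}. e' \<noteq> e \<longrightarrow> G l e' < G l e"
  \<comment> \<open>At the end point the tangent slope is 0, so the multiplier comes from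
    monotonicity instead of a stationarity condition.\<close>
  proof (cases "e = 1")
    case True
    have "G 0 e' < G 0 e" if "e' \<in> {0..1}" "e' \<noteq> e" for e'
      unfolding True by (rule G_zero_slope_less) (use that True in simp_all)
    then show ?thesis by blast
  next
    case False
    then have e1: "e < 1" using e by simp
    obtain l where "0 < l" "\<And>e'. e' \<in> {0..1} \<Longrightarrow> e' \<noteq> e \<Longrightarrow> G l e' < G l e"
      using supercritical_point[OF ec(1) Gc _ lc ece e1] G_le by metis
    then show ?thesis using less_imp_le by blast
  qed
  then obtain l where l: "0 \<le> l" and Gl: "\<And>e'. e' \<in> {0..1} \<Longrightarrow> e' \<noteq> e \<Longrightarrow> G l e' < G l e"
    by blast
  have M: "G l e' \<le> G l e" if "e' \<in> {0..1}" for e'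
    using Gl[OF that] by (cases "e' = e") auto
  have bd': "\<forall>w. weights w \<longrightarrow> E w - l * D w \<le> G l e"
    using lagrangian_bound(1)[OF l M] by blast
  have *: "1 * X (s * e) = l * (1 * X e) + G l e" by (simp add: G_def)
  have R_eq: "R * ln b = 1 * X e" using R by simp
  have "1 \<in> {0..1::real}" "e \<in> {0..1}" using ec e by auto
  note mm = minimal_maximizer_tight[OF l bd' this R_eq * min]
  have peak: "\<exists>x0. post W t = peaked e x0" if t: "t \<in> A" "0 < mass W t" for t
  proof -
    have "\<exists>e'\<in>{0..1}. \<exists>x0. post W t = peaked e' x0 \<and> G l e' = G l e"
      by (rule lagrangian_bound(2)[OF l _ weights_post[OF t(2)] mm(3)[OF t]]) (rule M)
    then show ?thesis using Gl by (metis less_irrefl)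
  qed
  show ?thesis
    by (rule all_peaked[OF mm(1) _ _ peak]) (use mm(2) ece ec e in simp_all)
qed

theorem minimal_maximizer_structure:
  fixes A :: "'t set" and W :: "'x \<Rightarrow> 't pmf"
  assumes R: "R \<in> {0..log b (real n)}" and min: "minimal_IB_maximizer b R unif V A W"
  shows "let R\<^sub>c = critical_rate b V in
    (R = 0 \<longrightarrow> card A = 1) \<and>
    (R \<in> {0<..<R\<^sub>c} \<longrightarrow>
       card A = n + 1 \<and>
       (let \<beta>\<^sub>c = h_inv b n (log b (real n) - R\<^sub>c) in
        \<exists>t\<^sub>0\<in>A. \<exists>\<tau> :: 'x \<Rightarrow> 't. bij_betw \<tau> UNIV (A - {t\<^sub>0}) \<and>
          (\<forall>x x'. pmf (W x) t\<^sub>0 = 1 - R / R\<^sub>c \<and>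
             pmf (W x) (\<tau> x') =
               (if x' = x then R / R\<^sub>c * (1 - (real n - 1) * \<beta>\<^sub>c) else R / R\<^sub>c * \<beta>\<^sub>c)))) \<and>
    (R \<in> {R\<^sub>c..log b (real n)} \<longrightarrow>
       card A = n \<and>
       (let \<beta> = h_inv b n (log b (real n) - R) in
        \<exists>\<tau> :: 'x \<Rightarrow> 't. bij_betw \<tau> UNIV A \<and>
          (\<forall>x x'. pmf (W x) (\<tau> x') = (if x' = x then 1 - (real n - 1) * \<beta> else \<beta>))))"
proof -
  obtain ec lc where ec: "0 < ec" "ec < 1" and lc: "0 < lc" and Gc: "G lc ec = 0"
    and G_le: "\<And>e. e \<in> {0..1} \<Longrightarrow> G lc e \<le> 0"
    and G_eq: "\<And>e. e \<in> {0..1} \<Longrightarrow> G lc e = 0 \<Longrightarrow> e = 0 \<or> e = ec"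
    using critical_point by metis
  have bound: "E w - lc * D w \<le> 0" if "weights w" for w :: "'x \<Rightarrow> real"
    by (rule lagrangian_bound(1)[OF less_imp_le[OF lc] G_le that])
  have tight: "w = (\<lambda>_. 1) \<or> (\<exists>x0. w = peaked ec x0)"
    if w: "weights w" "E w - lc * D w = 0" for w :: "'x \<Rightarrow> real"
  proof -
    have "\<exists>e\<in>{0..1}. \<exists>x0. w = peaked e x0 \<and> G lc e = 0"
      by (rule lagrangian_bound(2)[OF less_imp_le[OF lc] _ w]) (rule G_le)
    then show ?thesis using G_eq peaked_0 by metis
  qed
  have Rc: "critical_rate b V = X ec / ln b"
    by (rule critical_rate_tangent[OF ec lc Gc bound tight])
  have hc: "h_inv b n (log b (real n) - X ec / ln b) = (1 - ec) / real n"
    by (rule h_inv_X) (use ec in simp)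
  have "card A = 1" if "R = 0"
    by (rule zero_rate_maximizer[OF lc bound]) (use min that in simp_all)
  moreover have "card A = n + 1 \<and>
       (\<exists>t\<^sub>0\<in>A. \<exists>\<tau> :: 'x \<Rightarrow> 't. bij_betw \<tau> UNIV (A - {t\<^sub>0}) \<and>
          (\<forall>x x'. pmf (W x) t\<^sub>0 = 1 - R / (X ec / ln b) \<and>
             pmf (W x) (\<tau> x') =
               (if x' = x then R / (X ec / ln b) * (1 - (real n - 1) * ((1 - ec) / real n))
                else R / (X ec / ln b) * ((1 - ec) / real n))))"
    if "R \<in> {0<..<X ec / ln b}"
  proof -
    have pull: "(if c then a * u else a * v) = a * (if c then u else v)" for c and a u v :: real by simp
    show ?thesis
      unfolding pull peaked_channel_eq[symmetric]
      by (rule subcritical_maximizer[OF ec lc Gc bound tight _ _ min]) (use that in simp_all)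
  qed
  moreover have "card A = n \<and>
       (\<exists>\<tau> :: 'x \<Rightarrow> 't. bij_betw \<tau> UNIV A \<and>
          (\<forall>x x'. pmf (W x) (\<tau> x') =
             (if x' = x then 1 - (real n - 1) * h_inv b n (log b (real n) - R)
              else h_inv b n (log b (real n) - R))))"
    if Rge: "R \<in> {X ec / ln b..log b (real n)}"
  proof -
    obtain e where e: "e \<in> {0..1}" "R * ln b = X e" using X_surj[of R] R by auto
    have "R = X e / ln b" using e(2) lnb_pos by (simp add: field_simps)
    then have h: "h_inv b n (log b (real n) - R) = (1 - e) / real n" using h_inv_X[OF e(1)] by simp
    \<comment> \<open>Rates and peak parameters are ordered alike because \<open>X\<close>
      increases, so a rate from the critical one on means \<open>ec \<le> e\<close>.\<close>
    have "X ec \<le> X e" using Rge e(2) lnb_pos by (simp add: field_simps)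
    then have "ec \<le> e" using X_strict_mono[of e ec] e(1) ec by force
    then show ?thesis
      unfolding h peaked_channel_eq[symmetric]
      by (intro supercritical_maximizer[OF ec lc Gc G_le bound tight _ _ e(2) min]) (use e in auto)
  qed
  ultimately show ?thesis unfolding Let_def Rc hc by blast
qed

end

theorem theorem5:
  fixes b \<alpha> R :: real and n :: nat
    and A :: "'t set" and W :: "'x::finite \<Rightarrow> 't pmf"
  assumes "1 < b"
    and "CARD('x) = n" and "3 \<le> n"
    and "\<alpha> \<in> {0<..<1 / real n} \<union> {1 / real n<..<1 / (real n - 1)}"
    and "R \<in> {0..log b (real n)}"
    and "minimal_IB_maximizer b R (pmf_of_set (UNIV :: 'x set))
           (hamming_channel \<alpha> :: 'x \<Rightarrow> 'x pmf) A W"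
  shows "let R\<^sub>c = critical_rate b (hamming_channel \<alpha> :: 'x \<Rightarrow> 'x pmf) in
    (R = 0 \<longrightarrow> card A = 1) \<and>
    (R \<in> {0<..<R\<^sub>c} \<longrightarrow>
       card A = n + 1 \<and>
       (let \<beta>\<^sub>c = h_inv b n (log b (real n) - R\<^sub>c) in
        \<exists>t\<^sub>0\<in>A. \<exists>\<tau> :: 'x \<Rightarrow> 't. bij_betw \<tau> UNIV (A - {t\<^sub>0}) \<and>
          (\<forall>x x'. pmf (W x) t\<^sub>0 = 1 - R / R\<^sub>c \<and>
             pmf (W x) (\<tau> x') =
               (if x' = x then R / R\<^sub>c * (1 - (real n - 1) * \<beta>\<^sub>c) else R / R\<^sub>c * \<beta>\<^sub>c)))) \<and>
    (R \<in> {R\<^sub>c..log b (real n)} \<longrightarrow>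
       card A = n \<and>
       (let \<beta> = h_inv b n (log b (real n) - R) in
        \<exists>\<tau> :: 'x \<Rightarrow> 't. bij_betw \<tau> UNIV A \<and>
          (\<forall>x x'. pmf (W x) (\<tau> x') = (if x' = x then 1 - (real n - 1) * \<beta> else \<beta>))))"
proof -
  have n: "0 < real n" "0 < real n - 1" using assms(3) by auto
  have \<alpha>: "0 < \<alpha>" "\<alpha> < 1 / (real n - 1)" "real n * \<alpha> \<noteq> 1"
    using assms(4) n by (auto simp: field_simps)
  then have \<alpha>': "(real n - 1) * \<alpha> < 1" using n by (simp add: field_simps)
  \<comment> \<open>This is the bound \<alpha> < 1/(n - 1) in terms of
    \<open>s = 1 - n * \<alpha>\<close>.\<close>
  have "- 1 < (real n - 1) * (1 - real n * \<alpha>)"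
  proof -
    have "real n * ((real n - 1) * \<alpha>) < real n * 1"
      using n \<alpha>' by (intro mult_strict_left_mono) auto
    then show ?thesis by (simp add: algebra_simps)
  qed
  then interpret hamming_bottleneck n "1 - real n * \<alpha>" b \<alpha> "hamming_channel \<alpha> :: 'x \<Rightarrow> 'x pmf"
    using assms n \<alpha> \<alpha>' by unfold_locales auto
  show ?thesis by (rule minimal_maximizer_structure[OF assms(5,6)])
qed

end
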